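(* Let $K\ge 1$ and let $f\in\mathcal{S}_H^{0}(K,\Omega)$, where $\Omega=f(\mathbb{D})$ is a radial John disk (with respect to $f$). Then there are constants $C>0$ and $\delta\in(0,1)$ such that for all $\zeta_1,\zeta_2\in\mathbb{D}$, $$|f(\zeta_1)-f(\zeta_2)|\le C|\zeta_1-\zeta_2|^{\delta}.$$
   Context: $\mathbb{D}$ is the open unit disk in $\mathbb{C}$. For a domain $G\subset\mathbb{C}$ and $w\in G$, $d_G(w)$ is the Euclidean distance from $w$ to $\partial G$. $\mathcal{S}_H$ is the family of sense-preserving harmonic univalent mappings $f=h+\overline{g}$ of $\mathbb{D}$ with $h,g$ analytic in $\mathbb{D}$ and $h(0)=g(0)=h'(0)-1=0$; sense-preserving means $J_f=|h'|^2-|g'|^2>0$ in $\mathbb{D}$. $\mathcal{S}_H^0=\{f\in\mathcal{S}_H: g'(0)=0\}$. For $K\ge1$, a sense-preserving homeomorphism $f$ of a domain, of Sobolev class $W^{1,2}_{loc}$, is $K$-quasiconformal if $\|D_f(z)\|^2\le K|\det D_f(z)|$, i.e. $\|D_f(z)\|\le K\,l(D_f(z))$, where $\|D_f\|=|f_z|+|f_{\bar z}|$ and $l(D_f)=\big||f_z|-|f_{\bar z}|\big|$. $\mathcal{S}_H^0(K,\Omega)$ is the set of $f\in\mathcal{S}_H^0$ that are $K$-quasiconformal and map $\mathbb{D}$ onto the domain $\Omega\subset\mathbb{C}$. Radial John disk: let $f$ be a complex-valued univalent mapping of $\mathbb{D}$ and let $G=f(\mathbb{D})$ be a bounded simply connected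 domain. $G$ is a radial $c$-John disk ($c\ge1$) if for every $z\in\mathbb{D}$ the arc $\gamma=f([0,z])$, joining $w_1=f(z)$ to the John center $w_0=f(0)$, is rectifiable and satisfies: for every $w$ on $\gamma$, the Euclidean length of the subarc $\gamma[w_1,w]$ of $\gamma$ between $w_1$ and $w$ is at most $c\,d_G(w)$. $G$ is a radial John disk if it is a radial $c$-John disk for some $c\ge1$. *)

theory Defs
  imports "HOL-Complex_Analysis.Complex_Analysis"
begin

abbreviation unit_disk :: "complex set" where
  "unit_disk \<equiv> ball 0 1"

(* The Euclidean distance d_G(w) from w to the boundary of G. *)
definition bdry_dist :: "complex set \<Rightarrow> complex \<Rightarrow> real" where
  "bdry_dist G w = infdist w (frontier G)"


subsection \<open>Normalized harmonic univalent mappings\<close>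

(* The pair (h, g) is determined by f on the unit disk, so it does not matter that the
   normalizations of h and g are imposed below under separate existential quantifiers. *)
definition canonical_rep ::
    "(complex \<Rightarrow> complex) \<Rightarrow> (complex \<Rightarrow> complex) \<Rightarrow> (complex \<Rightarrow> complex) \<Rightarrow> bool" where
  "canonical_rep f h g \<longleftrightarrow>
     h holomorphic_on unit_disk \<and> g holomorphic_on unit_disk \<and> h 0 = 0 \<and> g 0 = 0 \<and>
     (\<forall>z\<in>unit_disk. f z = h z + cnj (g z))"

definition S_H :: "(complex \<Rightarrow> complex) set" where
  "S_H = {f. inj_on f unit_disk \<and>
     (\<exists>h g. canonical_rep f h g \<and> deriv h 0 - 1 = 0 \<and>
        (\<forall>z\<in>unit_disk. (cmod (deriv h z))\<^sup>2 - (cmod (deriv g z))\<^sup>2 > 0))}"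

definition S_H0 :: "(complex \<Rightarrow> complex) set" where
  "S_H0 = {f \<in> S_H. \<exists>h g. canonical_rep f h g \<and> deriv g 0 = 0}"


subsection \<open>The Sobolev class W^{1,2}_loc\<close>

definition locally_L2 :: "complex set \<Rightarrow> (complex \<Rightarrow> complex) \<Rightarrow> bool" where
  "locally_L2 U u \<longleftrightarrow>
     (\<forall>k. compact k \<and> k \<subseteq> U \<longrightarrow>
        set_borel_measurable lebesgue k u \<and> set_integrable lebesgue k (\<lambda>w. (cmod (u w))\<^sup>2))"

(* Weak derivatives are tested against continuously differentiable functions with compact
   support in U (as in Gilbarg and Trudinger); by mollification this gives the same weak
   derivatives as testing against smooth functions. *)
definition test_function :: "complex set \<Rightarrow> (complex \<Rightarrow> real) \<Rightarrow> bool" where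
  "test_function U \<phi> \<longleftrightarrow>
     (\<forall>w. \<phi> differentiable (at w)) \<and>
     (\<forall>v. continuous_on UNIV (\<lambda>w. frechet_derivative \<phi> (at w) v)) \<and>
     compact (closure {w. \<phi> w \<noteq> 0}) \<and> closure {w. \<phi> w \<noteq> 0} \<subseteq> U"

definition weak_dir_deriv ::
    "complex set \<Rightarrow> complex \<Rightarrow> (complex \<Rightarrow> complex) \<Rightarrow> (complex \<Rightarrow> complex) \<Rightarrow> bool" where
  "weak_dir_deriv U v f p \<longleftrightarrow>
     (\<forall>\<phi>. test_function U \<phi> \<longrightarrow>
        set_lebesgue_integral lebesgue U (\<lambda>w. frechet_derivative \<phi> (at w) v *\<^sub>R f w) =
        - set_lebesgue_integral lebesgue U (\<lambda>w. \<phi> w *\<^sub>R p w))"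

(* f belongs to W^{1,2}_loc(U), with weak partial derivatives p = f_x and q = f_y. *)
definition has_W12_loc_partials ::
    "complex set \<Rightarrow> (complex \<Rightarrow> complex) \<Rightarrow> (complex \<Rightarrow> complex) \<Rightarrow> (complex \<Rightarrow> complex) \<Rightarrow> bool" where
  "has_W12_loc_partials U f p q \<longleftrightarrow>
     locally_L2 U f \<and> locally_L2 U p \<and> locally_L2 U q \<and>
     weak_dir_deriv U 1 f p \<and> weak_dir_deriv U \<i> f q"


subsection \<open>Quasiconformal mappings\<close>

(* f_z and f_zbar, the operator norm and the Jacobian determinant of D_f,
   in terms of the values p = f_x and q = f_y. *)
definition wirt_z :: "complex \<Rightarrow> complex \<Rightarrow> complex" where
  "wirt_z p q = (p - \<i> * q) / 2"

definition wirt_zbar :: "complex \<Rightarrow> complex \<Rightarrow> complex" where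
  "wirt_zbar p q = (p + \<i> * q) / 2"

definition D_norm :: "complex \<Rightarrow> complex \<Rightarrow> real" where
  "D_norm p q = cmod (wirt_z p q) + cmod (wirt_zbar p q)"

definition D_det :: "complex \<Rightarrow> complex \<Rightarrow> real" where
  "D_det p q = (cmod (wirt_z p q))\<^sup>2 - (cmod (wirt_zbar p q))\<^sup>2"

(* A homeomorphism need not be differentiable, so preservation of orientation is expressed
   topologically: small positively oriented circles about z are mapped to loops winding
   once, in the positive direction, around f z. *)
definition sense_preserving_homeo :: "complex set \<Rightarrow> (complex \<Rightarrow> complex) \<Rightarrow> bool" where
  "sense_preserving_homeo U f \<longleftrightarrow>
     (\<exists>f'. homeomorphism U (f ` U) f f') \<and>
     (\<forall>z r. r > 0 \<and> cball z r \<subseteq> U \<longrightarrow> winding_number (f \<circ> circlepath z r) (f z) = 1)"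

(* D_f is the weak derivative, which is defined up to null sets; the distortion inequality
   is therefore required almost everywhere. *)
definition quasiconformal_on :: "real \<Rightarrow> complex set \<Rightarrow> (complex \<Rightarrow> complex) \<Rightarrow> bool" where
  "quasiconformal_on K U f \<longleftrightarrow>
     open U \<and> connected U \<and> U \<noteq> {} \<and> sense_preserving_homeo U f \<and>
     (\<exists>p q. has_W12_loc_partials U f p q \<and>
        (AE z in lebesgue. z \<in> U \<longrightarrow> (D_norm (p z) (q z))\<^sup>2 \<le> K * \<bar>D_det (p z) (q z)\<bar>))"

definition S_H0_qc :: "real \<Rightarrow> complex set \<Rightarrow> (complex \<Rightarrow> complex) set" where
  "S_H0_qc K \<Omega> =
     {f \<in> S_H0. quasiconformal_on K unit_disk f \<and> open \<Omega> \<and> connected \<Omega> \<and> f ` unit_disk = \<Omega>}"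


subsection \<open>Radial John disks\<close>

(* Length of the curve p restricted to [a, b]: the supremum over all partitions
   a \<le> t 0 \<le> ... \<le> t n \<le> b of the lengths of the inscribed polygons. *)
definition curve_length :: "(real \<Rightarrow> complex) \<Rightarrow> real \<Rightarrow> real \<Rightarrow> ennreal" where
  "curve_length p a b =
     (SUP (n, t) \<in> {(n :: nat, t :: nat \<Rightarrow> real). mono_on {..n} t \<and> t ` {..n} \<subseteq> {a..b}}.
        \<Sum>i<n. ennreal (dist (p (t i)) (p (t (Suc i)))))"

(* The arc f([0, z]) is parametrized by t \<mapsto> f (t z) on [0, 1]. A point w of it is f (t z), and
   the subarc between w_1 = f z and w corresponds to the parameter interval [t, 1]. *)
definition radial_c_John_disk :: "real \<Rightarrow> (complex \<Rightarrow> complex) \<Rightarrow> complex set \<Rightarrow> bool" where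
  "radial_c_John_disk c f G \<longleftrightarrow>
     c \<ge> 1 \<and> continuous_on unit_disk f \<and> inj_on f unit_disk \<and> G = f ` unit_disk \<and>
     open G \<and> bounded G \<and> simply_connected G \<and>
     (\<forall>z\<in>unit_disk.
        curve_length (\<lambda>s. f (of_real s * z)) 0 1 < \<infinity> \<and>
        (\<forall>t\<in>{0..1}. curve_length (\<lambda>s. f (of_real s * z)) t 1
                       \<le> ennreal (c * bdry_dist G (f (of_real t * z)))))"

definition radial_John_disk :: "(complex \<Rightarrow> complex) \<Rightarrow> complex set \<Rightarrow> bool" where
  "radial_John_disk f G \<longleftrightarrow> (\<exists>c\<ge>1. radial_c_John_disk c f G)"

end

theory Submission
  imports Defs "HOL-Real_Asymp.Real_Asymp"
begin

text \<open>
  Write \<open>f = h + cnj g\<close>, let \<open>\<Omega>\<close> be the image of the disk and \<open>d\<close> the distance to the boundary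
  of \<open>\<Omega>\<close>.  The proof shows that the images of the radii shrink at a geometric rate, and then
  lets harmonicity turn this radial information into information on the whole disk.

  Quasiconformality enters through one estimate.  Fix a unit vector \<open>e\<close> and let \<open>\<sigma>\<close> run from
  \<open>s\<close> down to \<open>l s\<close>.  If all the points \<open>f ((1 - \<sigma>) e)\<close> stayed within \<open>d / 2\<close> of
  \<open>w = f ((1 - s) e)\<close>, with \<open>d\<close> taken at \<open>w\<close>, then on each segment that leaves \<open>(1 - \<sigma>) e\<close> at an
  angle of 45 degrees to the radius the map \<open>f\<close> would have to travel a distance of at least
  \<open>d / 4\<close> before reaching the circle, because \<open>f\<close> maps onto a domain containing \<open>ball w d\<close>.  Such
  a segment has length at most a multiple of \<open>\<sigma>\<close>, so by Cauchy-Schwarz the Dirichlet integral of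
  \<open>f\<close> along it is at least a multiple of \<open>d\<^sup>2 / \<sigma>\<close>; integrating over \<open>\<sigma>\<close> gives a multiple
  of \<open>d\<^sup>2 ln (1 / l)\<close>.  On the other hand the part of the Dirichlet integral that lives over
  \<open>ball w d\<close> is at most \<open>K\<close> times the area of that ball.  Hence \<open>ln (1 / l)\<close> is at most a
  multiple of \<open>K\<close> (\<open>log_length_le_of_small_radial_oscillation\<close>): over a range of radii of fixed
  ratio, \<open>f\<close> moves along the radius by at least \<open>d / 2\<close>.

  The John condition bounds the length of the remaining arc by \<open>c d\<close>.  So each passage from \<open>s\<close>
  to \<open>l s\<close> uses up a fixed proportion of that length, the length decays like a power
  \<open>s powr \<delta>\<close>, and \<open>f\<close> is Hoelder continuous along radii (\<open>radial_Hoelder_of_John\<close>).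

  For the passage to the whole disk compare \<open>f\<close> with its dilate \<open>f (\<rho> z)\<close>, where \<open>1 - \<rho>\<close>
  is the distance of \<open>z\<close> to the circle.  The difference is harmonic and of size \<open>(1 - \<rho>) powr \<delta>\<close>
  near \<open>z\<close>, so the gradient of \<open>f\<close> at \<open>z\<close> exceeds the gradient at \<open>\<rho> z\<close> by at most a multiple
  of \<open>(1 - \<rho>) powr (\<delta> - 1)\<close>.  Summing a geometric series gives this same bound for the gradient
  itself (\<open>gradient_growth_of_radial_Hoelder\<close>), from which Hoelder continuity follows as in the
  classical theorem of Hardy and Littlewood (\<open>Hoelder_of_radial_Hoelder\<close>).

  Finally, the distortion inequality is given only almost everywhere and in terms of weak
  derivatives, whereas the area estimate uses the derivatives of \<open>h\<close> and \<open>g\<close>.  The first part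
  identifies the weak derivatives with the classical ones, and then continuity makes the inequality
  hold everywhere (\<open>qc_harmonic_dilatation\<close>).
\<close>

section \<open>Weak and classical derivatives\<close>

lemma continuous_extension_by_zero:
  fixes u :: "'a::euclidean_space \<Rightarrow> 'b::real_normed_vector"
  assumes U: "open U" and C: "compact C" "C \<subseteq> U" and u: "continuous_on U u"
    and z: "\<And>w. w \<in> U - C \<Longrightarrow> u w = 0"
  shows "continuous_on UNIV (\<lambda>w. indicator U w *\<^sub>R u w)"
proof -
  have "continuous_on U (\<lambda>w. indicator U w *\<^sub>R u w)"
    using u by (subst continuous_on_cong[OF refl, of U _ u]) auto
  moreover have "continuous_on (- C) (\<lambda>w. indicator U w *\<^sub>R u w)"
    by (subst continuous_on_cong[OF refl, of "- C" _ "\<lambda>_. 0"]) (use z in \<open>auto simp: indicator_def\<close>)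
  ultimately have "continuous_on (\<Union>{U, - C}) (\<lambda>w. indicator U w *\<^sub>R u w)"
    using U C by (intro continuous_on_open_Union) (auto intro: open_Compl compact_imp_closed)
  moreover have "\<Union>{U, - C} = UNIV" using C by auto
  ultimately show ?thesis by simp
qed

lemma integrable_continuous_compact_support:
  fixes u :: "complex \<Rightarrow> complex"
  assumes C: "compact C" and u: "continuous_on UNIV u" and z: "\<And>w. w \<notin> C \<Longrightarrow> u w = 0"
  shows "integrable lborel u"
proof -
  have "integrable lborel (\<lambda>w. indicator C w *\<^sub>R u w)"
    using C u by (intro borel_integrable_compact) (auto elim: continuous_on_subset)
  also have "(\<lambda>w. indicator C w *\<^sub>R u w) = u" using z by (auto simp: indicator_def fun_eq_iff)
  finally show ?thesis .
qed

text \<open>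
  The integral of \<open>F (w + t v)\<close> over \<open>w\<close> does not depend on \<open>t\<close>, so difference quotients
  of \<open>F\<close> in direction \<open>v\<close> have integral \<open>0\<close>; dominated convergence passes this on to the
  derivative.  Translation invariance thus takes the place of Fubini's theorem here.
\<close>

lemma integral_directional_derivative_eq_0:
  fixes F :: "complex \<Rightarrow> complex"
  assumes der: "\<And>w. (F has_derivative F' w) (at w)" and cont: "continuous_on UNIV (\<lambda>w. F' w v)"
    and C: "compact C" and z: "\<And>w. w \<notin> C \<Longrightarrow> F w = 0"
  shows "integral\<^sup>L lborel (\<lambda>w. F' w v) = 0"
proof -
  have contF: "continuous_on UNIV F"
    by (intro continuous_at_imp_continuous_on ballI has_derivative_continuous[OF der])
  have z': "F' w v = 0" if "w \<notin> C" for w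
  proof -
    have "((\<lambda>_. 0) has_derivative F' w) (at w)"
      by (rule has_derivative_transform_within_open[OF der, of "- C"])
         (use C z that in \<open>auto intro: compact_imp_closed\<close>)
    then have "F' w = (\<lambda>_. 0)" by (rule has_derivative_unique) simp
    then show ?thesis by simp
  qed
  have "bounded ((\<lambda>w. F' w v) ` C)"
    using C cont by (intro compact_imp_bounded compact_continuous_image) (auto elim: continuous_on_subset)
  then obtain B where B: "0 < B" "\<And>w. w \<in> C \<Longrightarrow> cmod (F' w v) \<le> B"
    unfolding bounded_pos by auto
  have B': "cmod (F' w v) \<le> B" for w using B z'[of w] by (cases "w \<in> C") auto
  obtain R where R: "0 < R" "\<And>w. w \<in> C \<Longrightarrow> cmod w \<le> R"
    using compact_imp_bounded[OF C] unfolding bounded_pos by blast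
  define h where "h n = inverse (real (Suc n))" for n
  have h: "0 < h n" "h n \<le> 1" for n by (simp_all add: h_def field_simps)
  define s where "s n w = (F (w + h n *\<^sub>R v) - F w) /\<^sub>R h n" for n w
  have intF: "integrable lborel F" by (rule integrable_continuous_compact_support[OF C contF z])
  have trans: "integrable lborel (\<lambda>w. F (w + a)) \<and> integral\<^sup>L lborel (\<lambda>w. F (w + a)) = integral\<^sup>L lborel F" for a
  proof -
    have mF: "F \<in> borel_measurable borel" using contF by (rule borel_measurable_continuous_onI)
    have "integrable (distr lborel borel ((+) a)) F" using intF by (simp add: lborel_distr_plus)
    then have 1: "integrable lborel (\<lambda>w. F (a + w))" using mF by (subst (asm) integrable_distr_eq) auto
    have "integral\<^sup>L (distr lborel borel ((+) a)) F = integral\<^sup>L lborel (\<lambda>w. F (a + w))"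
      using mF by (subst integral_distr) auto
    then show ?thesis using 1 by (simp add: lborel_distr_plus add.commute)
  qed
  have s0: "integral\<^sup>L lborel (s n) = 0" for n
    unfolding s_def using trans[of "h n *\<^sub>R v"] intF by simp
  have "(\<lambda>n. integral\<^sup>L lborel (s n)) \<longlonglongrightarrow> integral\<^sup>L lborel (\<lambda>w. F' w v)"
  proof (rule integral_dominated_convergence)
    show "(\<lambda>w. F' w v) \<in> borel_measurable lborel"
      using cont by (simp add: borel_measurable_continuous_onI)
    show "s n \<in> borel_measurable lborel" for n
      unfolding s_def using contF
      by (auto intro!: borel_measurable_continuous_onI continuous_intros continuous_on_compose2[OF contF])
    show "integrable lborel (\<lambda>w. indicator (cball 0 (R + cmod v)) w *\<^sub>R B)"
      by (intro borel_integrable_compact) auto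
    show "AE w in lborel. (\<lambda>n. s n w) \<longlonglongrightarrow> F' w v"
    proof (rule AE_I2)
      fix w
      have "((\<lambda>t::real. F (w + t *\<^sub>R v)) has_derivative (\<lambda>t. F' (w + 0 *\<^sub>R v) (t *\<^sub>R v))) (at 0)"
        by (rule has_derivative_compose[where g = F, OF _ der]) (auto intro!: derivative_eq_intros)
      moreover have "F' w (t *\<^sub>R v) = t *\<^sub>R F' w v" for t
        using has_derivative_linear[OF der] by (rule linear_scale)
      ultimately have "((\<lambda>t. norm (F (w + t *\<^sub>R v) - F w - t *\<^sub>R F' w v) / norm t) \<longlongrightarrow> 0) (at 0)"
        by (simp add: has_derivative_at)
      moreover have "norm (F (w + t *\<^sub>R v) - F w - t *\<^sub>R F' w v) / norm t
          = norm ((F (w + t *\<^sub>R v) - F w) /\<^sub>R t - F' w v)" if "t \<noteq> 0" for t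
      proof -
        have "(F (w + t *\<^sub>R v) - F w) /\<^sub>R t - F' w v = (F (w + t *\<^sub>R v) - F w - t *\<^sub>R F' w v) /\<^sub>R t"
          using that by (simp add: scaleR_diff_right)
        then show ?thesis by (simp add: divide_inverse mult.commute)
      qed
      ultimately have "((\<lambda>t. norm ((F (w + t *\<^sub>R v) - F w) /\<^sub>R t - F' w v)) \<longlongrightarrow> 0) (at 0)"
        by (elim Lim_transform_eventually) (auto simp: eventually_at_filter)
      then have "((\<lambda>t. (F (w + t *\<^sub>R v) - F w) /\<^sub>R t) \<longlongrightarrow> F' w v) (at 0)"
        by (simp only: tendsto_norm_zero_iff LIM_zero_iff)
      moreover have "filterlim h (at 0) sequentially"
        unfolding filterlim_at using h LIMSEQ_inverse_real_of_nat by (auto simp: h_def[abs_def])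
      ultimately show "(\<lambda>n. s n w) \<longlonglongrightarrow> F' w v"
        unfolding s_def by (rule filterlim_compose)
    qed
    show "AE w in lborel. norm (s n w) \<le> indicator (cball 0 (R + cmod v)) w *\<^sub>R B" for n
    proof (rule AE_I2)
      fix w
      show "norm (s n w) \<le> indicator (cball 0 (R + cmod v)) w *\<^sub>R B"
      proof (cases "w \<in> cball 0 (R + cmod v)")
        case True
        have "norm (F (w + h n *\<^sub>R v) - F (w + 0 *\<^sub>R v)) \<le> B * norm (h n - 0)"
        proof (rule differentiable_bound[where S = UNIV and f = "\<lambda>t::real. F (w + t *\<^sub>R v)"])
          fix t :: real
          show "((\<lambda>t::real. F (w + t *\<^sub>R v)) has_derivative (\<lambda>x. F' (w + t *\<^sub>R v) (x *\<^sub>R v))) (at t within UNIV)"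
            by (rule has_derivative_compose[where g = F, OF _ der]) (auto intro!: derivative_eq_intros)
          have "F' (w + t *\<^sub>R v) (x *\<^sub>R v) = x *\<^sub>R F' (w + t *\<^sub>R v) v" for x
            using has_derivative_linear[OF der] by (rule linear_scale)
          then show "onorm (\<lambda>x. F' (w + t *\<^sub>R v) (x *\<^sub>R v)) \<le> B"
            using B' by (intro onorm_le) (simp add: mult.commute[of B] mult_left_mono)
        qed auto
        moreover have "norm (s n w) = norm (F (w + h n *\<^sub>R v) - F w) / h n"
          unfolding s_def norm_scaleR using h[of n] by (simp add: divide_inverse mult.commute)
        ultimately have "norm (s n w) \<le> B"
          using h[of n] by (simp add: pos_divide_le_eq)
        then show ?thesis using True by simp
      next
        case False
        have "h n * cmod v \<le> cmod v" using h[of n] by (simp add: mult_left_le_one_le)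
        then have "cmod (w + h n *\<^sub>R v) \<ge> cmod w - cmod v"
          using norm_diff_ineq[of w "h n *\<^sub>R v"] h[of n] by simp
        then have "w \<notin> C" "w + h n *\<^sub>R v \<notin> C" using False R(2) norm_ge_zero[of v] by fastforce+
        then show ?thesis using z B(1) by (simp add: s_def)
      qed
    qed
  qed
  then show ?thesis using s0 by (simp add: LIMSEQ_const_iff)
qed

text \<open>
  Integration by parts, applied to the product \<open>\<phi> f\<close> extended by \<open>0\<close>, shows that the classical
  derivative is a weak derivative as well.
\<close>

lemma weak_dir_deriv_eq_classical:
  fixes f p :: "complex \<Rightarrow> complex"
  assumes U: "open U" and der: "\<And>w. w \<in> U \<Longrightarrow> (f has_derivative f' w) (at w)"
    and cont: "continuous_on U (\<lambda>w. f' w v)"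
    and weak: "weak_dir_deriv U v f p" and \<phi>: "test_function U \<phi>"
  shows "set_lebesgue_integral lebesgue U (\<lambda>w. \<phi> w *\<^sub>R p w) = set_lebesgue_integral lebesgue U (\<lambda>w. \<phi> w *\<^sub>R f' w v)"
proof -
  define C where "C = closure {w. \<phi> w \<noteq> 0}"
  define D where "D w = frechet_derivative \<phi> (at w)" for w
  have C: "compact C" "C \<subseteq> U" and diff: "\<And>w. \<phi> differentiable (at w)" and contD: "continuous_on UNIV (\<lambda>w. D w v)"
    using \<phi> by (auto simp: test_function_def C_def D_def)
  have der\<phi>: "(\<phi> has_derivative D w) (at w)" for w
    using diff by (simp add: D_def frechet_derivative_works[symmetric])
  have zC: "\<phi> w = 0" if "w \<notin> C" for w using that closure_subset[of "{w. \<phi> w \<noteq> 0}"] by (auto simp: C_def)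
  have zD: "D w v = 0" if "w \<notin> C" for w
  proof -
    have "((\<lambda>_. 0) has_derivative D w) (at w)"
      by (rule has_derivative_transform_within_open[OF der\<phi>, of "- C"])
         (use C zC that in \<open>auto intro: compact_imp_closed\<close>)
    then have "D w = (\<lambda>_. 0)" by (rule has_derivative_unique) simp
    then show ?thesis by simp
  qed
  have contf: "continuous_on U f"
    by (intro continuous_at_imp_continuous_on ballI has_derivative_continuous[OF der])
  have cont\<phi>: "continuous_on A \<phi>" for A
    by (intro continuous_at_imp_continuous_on ballI has_derivative_continuous[OF der\<phi>])
  define a where "a w = indicator U w *\<^sub>R (D w v *\<^sub>R f w)" for w
  define b where "b w = indicator U w *\<^sub>R (\<phi> w *\<^sub>R f' w v)" for w
  have ca: "continuous_on UNIV a" unfolding a_def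
    using zD contD by (intro continuous_extension_by_zero[OF U C] continuous_intros contf)
      (auto elim: continuous_on_subset)
  have cb: "continuous_on UNIV b" unfolding b_def
    using zC by (intro continuous_extension_by_zero[OF U C] continuous_intros cont cont\<phi>) auto
  have ia: "integrable lborel a"
    by (rule integrable_continuous_compact_support[OF C(1) ca]) (simp add: a_def zD)
  have ib: "integrable lborel b"
    by (rule integrable_continuous_compact_support[OF C(1) cb]) (simp add: b_def zC)
  define F where "F w = indicator U w *\<^sub>R (\<phi> w *\<^sub>R f w)" for w
  define F' where "F' w = (\<lambda>x. if w \<in> U then D w x *\<^sub>R f w + \<phi> w *\<^sub>R f' w x else 0)" for w
  have derF: "(F has_derivative F' w) (at w)" for w
  proof (cases "w \<in> U")
    case True
    have "((\<lambda>w. \<phi> w *\<^sub>R f w) has_derivative (\<lambda>x. \<phi> w *\<^sub>R f' w x + D w x *\<^sub>R f w)) (at w)"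
      by (rule has_derivative_scaleR[OF der\<phi> der[OF True]])
    then have "((\<lambda>w. \<phi> w *\<^sub>R f w) has_derivative F' w) (at w)"
      by (rule has_derivative_eq_rhs) (auto simp: F'_def True)
    then show ?thesis
      by (rule has_derivative_transform_within_open[OF _ U True]) (simp add: F_def)
  next
    case False
    then have w: "w \<in> - C" using C by auto
    have "((\<lambda>_. 0) has_derivative F' w) (at w)" using False by (simp add: F'_def)
    then show ?thesis
      by (rule has_derivative_transform_within_open[OF _ _ w])
         (use C zC in \<open>auto simp: F_def intro: open_Compl compact_imp_closed\<close>)
  qed
  have F'ab: "(\<lambda>w. F' w v) = (\<lambda>w. a w + b w)"
    by (auto simp: F'_def a_def b_def fun_eq_iff)
  have "integral\<^sup>L lborel (\<lambda>w. F' w v) = 0"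
  proof (rule integral_directional_derivative_eq_0[OF derF _ C(1)])
    show "continuous_on UNIV (\<lambda>w. F' w v)" unfolding F'ab by (intro continuous_on_add ca cb)
    show "F w = 0" if "w \<notin> C" for w using zC[OF that] by (simp add: F_def)
  qed
  then have "integral\<^sup>L lborel a = - integral\<^sup>L lborel b"
    using ia ib by (simp add: F'ab add_eq_0_iff)
  then have "integral\<^sup>L lebesgue a = - integral\<^sup>L lebesgue b"
    using ca cb by (simp add: integral_completion borel_measurable_continuous_onI)
  moreover have "integral\<^sup>L lebesgue a = - set_lebesgue_integral lebesgue U (\<lambda>w. \<phi> w *\<^sub>R p w)"
    using weak \<phi> by (auto simp: weak_dir_deriv_def set_lebesgue_integral_def a_def[abs_def] D_def)
  ultimately show ?thesis
    by (simp add: set_lebesgue_integral_def b_def[abs_def])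
qed


text \<open>
  The sets over which \<open>u\<close>, cut off outside \<open>box a b\<close>, integrates to \<open>0\<close> form a Dynkin system that
  contains the boxes, hence all Borel sets; they also contain the Lebesgue sets, which differ from
  Borel sets by null sets.
\<close>

lemma AE_eq_0_of_box_integrals:
  fixes u :: "complex \<Rightarrow> complex"
  assumes int: "set_integrable lebesgue (box a b) u"
    and box0: "\<And>c d. box c d \<noteq> {} \<Longrightarrow> cbox c d \<subseteq> cbox a b \<Longrightarrow> set_lebesgue_integral lebesgue (box c d) u = 0"
  shows "AE w in lebesgue. w \<in> box a b \<longrightarrow> u w = 0"
proof -
  define v where "v w = indicator (box a b) w *\<^sub>R u w" for w
  have iv: "integrable lebesgue v" using int by (simp add: set_integrable_def v_def[abs_def])
  have siv: "set_integrable lebesgue A v" if "A \<in> sets lebesgue" for A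
    unfolding set_integrable_def using iv that by (intro integrable_mult_indicator)
  have leb: "A \<in> sets lebesgue" if "A \<in> sets borel" for A :: "complex set"
    using that by (simp add: sets_completionI_sets)
  have vbox: "set_lebesgue_integral lebesgue (box c d) v = 0" for c d
  proof -
    \<comment> \<open>The hypothesis only speaks of boxes whose closure lies in \<open>cbox a b\<close>; a nonempty box cut down
      to \<open>box a b\<close> has this property because its closure is the corresponding closed box.\<close>
    obtain c' d' where cd: "box c d \<inter> box a b = box c' d'" using box_Int_box[of c d a b] by blast
    have "set_lebesgue_integral lebesgue (box c d) v = set_lebesgue_integral lebesgue (box c' d') u"
      unfolding set_lebesgue_integral_def
      by (rule Bochner_Integration.integral_cong) (auto simp: v_def cd[symmetric] indicator_def)
    also have "\<dots> = 0"
    proof (cases "box c' d' = {}")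
      case True then show ?thesis by (simp add: set_lebesgue_integral_def)
    next
      case False
      have "cbox c' d' = closure (box c' d')" using False by (simp add: closure_box)
      also have "\<dots> \<subseteq> closure (box a b)" using cd by (intro closure_mono) auto
      also have "\<dots> \<subseteq> cbox a b" by (intro closure_minimal box_subset_cbox closed_cbox)
      finally show ?thesis using box0 False by blast
    qed
    finally show ?thesis .
  qed
  have UNIV0: "set_lebesgue_integral lebesgue UNIV v = 0"
  proof -
    have "set_lebesgue_integral lebesgue UNIV v = set_lebesgue_integral lebesgue (box a b) v"
      unfolding set_lebesgue_integral_def
      by (rule Bochner_Integration.integral_cong) (auto simp: v_def indicator_def)
    then show ?thesis using vbox by simp
  qed
  have borel0: "set_lebesgue_integral lebesgue A v = 0" if "A \<in> sets borel" for A
  proof -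
    have "Int_stable (range (\<lambda>(a, b). box a b :: complex set))"
      by (auto simp: Int_stable_def box_Int_box)
    moreover have "range (\<lambda>(a, b). box a b :: complex set) \<subseteq> Pow UNIV" by auto
    moreover have "A \<in> sigma_sets UNIV (range (\<lambda>(a, b). box a b))"
      using that unfolding borel_eq_box by simp
    ultimately show ?thesis
    proof (induction rule: sigma_sets_induct_disjoint)
      case (basic A) then show ?case using vbox by auto
    next
      case empty then show ?case by (simp add: set_lebesgue_integral_def)
    next
      case (compl A)
      then have A: "A \<in> sets lebesgue" by (intro leb) (simp add: borel_eq_box)
      have "set_lebesgue_integral lebesgue (A \<union> (UNIV - A)) v
          = set_lebesgue_integral lebesgue A v + set_lebesgue_integral lebesgue (UNIV - A) v"
        using A by (intro set_integral_Un siv) auto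
      then show ?case using UNIV0 compl by simp
    next
      case (union F)
      then have F: "F i \<in> sets lebesgue" for i by (intro leb) (simp add: borel_eq_box subset_eq)
      have "set_lebesgue_integral lebesgue (\<Union>i. F i) v = (\<Sum>i. set_lebesgue_integral lebesgue (F i) v)"
        using union(1) F by (intro lebesgue_integral_countable_add siv) (auto simp: disjoint_family_on_def)
      then show ?case using union by simp
    qed
  qed
  have leb0: "set_lebesgue_integral lebesgue A v = 0" if "A \<in> sets lebesgue" for A
  proof -
    from that obtain S N N' where A: "A = S \<union> N" "N \<subseteq> N'" "N' \<in> null_sets lborel" "S \<in> sets lborel"
      by (rule sets_completionE)
    have "N' \<in> null_sets lebesgue" using A(3) by (rule null_sets_completionI)
    then have "AE w in lebesgue. w \<notin> N'" by (rule AE_not_in)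
    then have "set_lebesgue_integral lebesgue A v = set_lebesgue_integral lebesgue S v"
      unfolding set_lebesgue_integral_def
    proof (intro integral_cong_AE)
      show "(\<lambda>x. indicator A x *\<^sub>R v x) \<in> borel_measurable lebesgue"
        using siv[OF that] by (simp add: set_integrable_def borel_measurable_integrable)
      show "(\<lambda>x. indicator S x *\<^sub>R v x) \<in> borel_measurable lebesgue"
        using siv[OF leb] A(4) by (simp add: set_integrable_def borel_measurable_integrable)
      assume "AE w in lebesgue. w \<notin> N'"
      then show "AE x in lebesgue. indicator A x *\<^sub>R v x = indicator S x *\<^sub>R v x"
        by eventually_elim (use A in \<open>auto simp: indicator_def\<close>)
    qed
    also have "\<dots> = 0" using borel0 A by simp
    finally show ?thesis .
  qed
  have "AE w in lebesgue. k (v w) = 0" if k: "bounded_linear k" for k :: "complex \<Rightarrow> real"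
  proof (rule density_unique_real)
    show "integrable lebesgue (\<lambda>w. k (v w))" by (rule integrable_bounded_linear[OF k iv])
    fix A :: "complex set" assume A: "A \<in> sets lebesgue"
    have "(LINT w:A|lebesgue. k (v w)) = (LINT w|lebesgue. k (indicator A w *\<^sub>R v w))"
      unfolding set_lebesgue_integral_def by (simp add: linear_scale[OF bounded_linear.linear[OF k]])
    also have "\<dots> = k (LINT w:A|lebesgue. v w)"
      unfolding set_lebesgue_integral_def
      by (rule integral_bounded_linear[OF k]) (use siv[OF A] in \<open>simp add: set_integrable_def\<close>)
    also have "\<dots> = k 0" using leb0[OF A] by simp
    also have "k 0 = 0" by (rule linear_0[OF bounded_linear.linear[OF k]])
    finally show "(LINT w:A|lebesgue. k (v w)) = (LINT w:A|lebesgue. 0)"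
      by (simp add: set_lebesgue_integral_def)
  qed simp
  from this[OF bounded_linear_Re] this[OF bounded_linear_Im]
  show ?thesis by eventually_elim (auto simp: v_def complex_eq_iff)
qed

text \<open>
  The square makes this a continuously differentiable function that is positive exactly on the
  positive half-line.
\<close>

definition sqpos :: "real \<Rightarrow> real" where "sqpos t = (max 0 t)\<^sup>2"

lemma sqpos_has_derivative: "(sqpos has_field_derivative 2 * max 0 t) (at t)"
proof -
  consider "t > 0" | "t < 0" | "t = 0" by linarith
  then show ?thesis
  proof cases
    case 1
    have "((\<lambda>t. t\<^sup>2) has_field_derivative 2 * max 0 t) (at t)"
      using 1 by (auto intro!: derivative_eq_intros)
    then show ?thesis
      by (rule has_field_derivative_transform_within_open[of _ _ _ "{0<..}"]) (use 1 in \<open>auto simp: sqpos_def\<close>)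
  next
    case 2
    have "((\<lambda>t. 0) has_field_derivative 2 * max 0 t) (at t)" using 2 by auto
    then show ?thesis
      by (rule has_field_derivative_transform_within_open[of _ _ _ "{..<0}"]) (use 2 in \<open>auto simp: sqpos_def\<close>)
  next
    case 3
    have "((\<lambda>h. max 0 h) \<longlongrightarrow> max 0 0) (at (0::real))" by (intro tendsto_intros)
    then have "((\<lambda>h. (sqpos (0 + h) - sqpos 0) / h) \<longlongrightarrow> max 0 0) (at 0)"
      by (rule Lim_transform_eventually)
         (auto simp: eventually_at_filter sqpos_def power2_eq_square max_def)
    then show ?thesis using 3 by (simp add: DERIV_def)
  qed
qed

text \<open>
  Positive exactly on the box, if the box is nonempty.  For such a bump \<open>s\<close> the test functions
  \<open>n s / (1 + n s)\<close> with values in \<open>[0, 1)\<close> tend to the indicator of the box.  This is how the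
  weak derivative, which is known only against test functions, is integrated over boxes.
\<close>

definition box_bump :: "complex \<Rightarrow> complex \<Rightarrow> complex \<Rightarrow> real" where
  "box_bump a b w = sqpos ((Re w - Re a) * (Re b - Re w)) * sqpos ((Im w - Im a) * (Im b - Im w))"

lemma box_bump_nonneg: "0 \<le> box_bump a b w" by (simp add: box_bump_def sqpos_def)

lemma in_box_complex_iff: "w \<in> box a b \<longleftrightarrow> Re a < Re w \<and> Re w < Re b \<and> Im a < Im w \<and> Im w < Im b"
  by (auto simp: mem_box Basis_complex_def)

lemma box_bump_pos_iff:
  assumes "box a b \<noteq> {}"
  shows "0 < box_bump a b w \<longleftrightarrow> w \<in> box a b"
proof -
  have ab: "Re a < Re b" "Im a < Im b" using assms by (auto simp: in_box_complex_iff)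
  have *: "0 < (x - c) * (d - x) \<longleftrightarrow> c < x \<and> x < d" if "c < d" for c d x :: real
    using that by (auto simp: zero_less_mult_iff)
  have **: "0 < sqpos t \<longleftrightarrow> 0 < t" for t by (auto simp: sqpos_def max_def)
  have "0 < box_bump a b w \<longleftrightarrow> 0 < sqpos ((Re w - Re a) * (Re b - Re w)) \<and> 0 < sqpos ((Im w - Im a) * (Im b - Im w))"
    unfolding box_bump_def by (auto simp: zero_less_mult_iff sqpos_def)
  then show ?thesis unfolding ** using *[OF ab(1)] *[OF ab(2)] by (auto simp: in_box_complex_iff)
qed

lemma test_function_box_bump:
  assumes ab: "box a b \<noteq> {}" "cbox a b \<subseteq> U" and r: "r \<ge> 0"
  shows "test_function U (\<lambda>w. r * box_bump a b w / (1 + r * box_bump a b w))"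
proof -
  let ?X = "\<lambda>w. (Re w - Re a) * (Re b - Re w)" and ?Y = "\<lambda>w. (Im w - Im a) * (Im b - Im w)"
  define S' where "S' w v = sqpos (?X w) * (2 * max 0 (?Y w) * (Im v * (Im b - Im w) - (Im w - Im a) * Im v))
     + (2 * max 0 (?X w) * (Re v * (Re b - Re w) - (Re w - Re a) * Re v)) * sqpos (?Y w)" for w v
  have chain: "((\<lambda>w. sqpos (k w)) has_derivative (\<lambda>v. 2 * max 0 (k w) * k' v)) (at w)"
    if "(k has_derivative k') (at w)" for k k' and w :: complex
    using has_derivative_compose[OF that sqpos_has_derivative[unfolded has_field_derivative_def]] by simp
  have dX: "(?X has_derivative (\<lambda>v. Re v * (Re b - Re w) - (Re w - Re a) * Re v)) (at w)" for w
    by (auto intro!: derivative_eq_intros simp: algebra_simps)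
  have dY: "(?Y has_derivative (\<lambda>v. Im v * (Im b - Im w) - (Im w - Im a) * Im v)) (at w)" for w
    by (auto intro!: derivative_eq_intros simp: algebra_simps)
  have dS: "(box_bump a b has_derivative S' w) (at w)" for w
    unfolding box_bump_def[abs_def] S'_def[abs_def]
    using has_derivative_mult[OF chain[OF dX] chain[OF dY]] by simp
  define \<phi> where "\<phi> = (\<lambda>w. r * box_bump a b w / (1 + r * box_bump a b w))"
  have pos: "1 + r * box_bump a b w > 0" for w
    using r box_bump_nonneg[of a b w] by (simp add: add_pos_nonneg)
  have ne: "1 + r * box_bump a b w \<noteq> 0" for w using pos[of w] by linarith
  have d\<phi>: "(\<phi> has_derivative (\<lambda>v. r * S' w v / (1 + r * box_bump a b w)\<^sup>2)) (at w)" for w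
    unfolding \<phi>_def using pos[of w]
    by (auto intro!: derivative_eq_intros dS simp: fun_eq_iff field_simps power2_eq_square)
  have contsq: "continuous_on A sqpos" for A
    unfolding sqpos_def by (intro continuous_intros)
  have contS: "continuous_on UNIV (\<lambda>w. S' w v)" for v
    unfolding S'_def by (intro continuous_intros continuous_on_compose2[OF contsq[of UNIV]]) auto
  have contb: "continuous_on UNIV (box_bump a b)"
    by (intro continuous_at_imp_continuous_on ballI has_derivative_continuous[OF dS])
  have fd: "frechet_derivative \<phi> (at w) = (\<lambda>v. r * S' w v / (1 + r * box_bump a b w)\<^sup>2)" for w
    using frechet_derivative_at[OF d\<phi>] by simp
  have supp: "{w. \<phi> w \<noteq> 0} \<subseteq> box a b"
    using box_bump_pos_iff[OF ab(1)] box_bump_nonneg[of a b] by (auto simp: \<phi>_def less_le)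
  then have cl: "closure {w. \<phi> w \<noteq> 0} \<subseteq> cbox a b"
    using box_subset_cbox by (intro closure_minimal) auto
  have "test_function U \<phi>"
    unfolding test_function_def
  proof (intro conjI allI)
    show "\<phi> differentiable at w" for w using d\<phi> by (auto simp: differentiable_def)
    show "continuous_on UNIV (\<lambda>w. frechet_derivative \<phi> (at w) v)" for v
      unfolding fd by (intro continuous_intros contS contb) (auto simp: ne)
    show "compact (closure {w. \<phi> w \<noteq> 0})"
      using cl by (meson bounded_cbox bounded_subset closed_closure compact_eq_bounded_closed)
    show "closure {w. \<phi> w \<noteq> 0} \<subseteq> U" using cl ab by blast
  qed
  then show ?thesis by (simp add: \<phi>_def)
qed

lemma box_bump_integrals_tendsto:
  fixes p :: "complex \<Rightarrow> complex"
  assumes ab: "box a b \<noteq> {}" "cbox a b \<subseteq> U" and int: "set_integrable lebesgue (cbox a b) p"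
  shows "(\<lambda>n. set_lebesgue_integral lebesgue U (\<lambda>w. (real n * box_bump a b w / (1 + real n * box_bump a b w)) *\<^sub>R p w))
     \<longlonglongrightarrow> set_lebesgue_integral lebesgue (box a b) p"
proof -
  define \<phi> where "\<phi> n w = real n * box_bump a b w / (1 + real n * box_bump a b w)" for n w
  define P where "P w = indicator (cbox a b) w *\<^sub>R p w" for w
  have iP: "integrable lebesgue P" using int by (simp add: set_integrable_def P_def[abs_def])
  have b0: "box_bump a b w = 0" if "w \<notin> box a b" for w
    using box_bump_pos_iff[OF ab(1), of w] box_bump_nonneg[of a b w] that by simp
  have \<phi>01: "0 \<le> \<phi> n w" "\<phi> n w \<le> 1" for n w
    using box_bump_nonneg[of a b w] by (auto simp: \<phi>_def divide_le_eq add_nonneg_nonneg add_pos_nonneg)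
  have e1: "indicator U w *\<^sub>R (\<phi> n w *\<^sub>R p w) = \<phi> n w *\<^sub>R P w" for n w
    using b0[of w] ab(2) box_subset_cbox[of a b] by (cases "w \<in> box a b") (auto simp: P_def \<phi>_def indicator_def)
  have e2: "indicator (box a b) w *\<^sub>R p w = indicator (box a b) w *\<^sub>R P w" for w
    using box_subset_cbox[of a b] by (auto simp: P_def indicator_def)
  have contb: "continuous_on UNIV (box_bump a b)"
    unfolding box_bump_def sqpos_def by (intro continuous_intros)
  have pos: "1 + real n * box_bump a b w \<noteq> 0" for n w
  proof -
    have "0 \<le> real n * box_bump a b w" by (intro mult_nonneg_nonneg box_bump_nonneg) simp
    then show ?thesis by linarith
  qed
  have m\<phi>: "\<phi> n \<in> borel_measurable lebesgue" for n
  proof -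
    have "continuous_on UNIV (\<phi> n)" unfolding \<phi>_def using pos by (intro continuous_intros contb) auto
    then have "\<phi> n \<in> borel_measurable lborel" by (simp add: borel_measurable_continuous_onI)
    then show ?thesis by (rule measurable_completion)
  qed
  have "(\<lambda>n. integral\<^sup>L lebesgue (\<lambda>w. \<phi> n w *\<^sub>R P w)) \<longlonglongrightarrow> integral\<^sup>L lebesgue (\<lambda>w. indicator (box a b) w *\<^sub>R P w)"
  proof (rule integral_dominated_convergence)
    have mb: "box a b \<in> sets lebesgue" by (simp add: sets_completionI_sets)
    show "(\<lambda>w. indicator (box a b) w *\<^sub>R P w) \<in> borel_measurable lebesgue"
      using mb iP by (intro borel_measurable_scaleR borel_measurable_indicator) auto
    show "(\<lambda>w. \<phi> n w *\<^sub>R P w) \<in> borel_measurable lebesgue" for n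
      using iP by (intro borel_measurable_scaleR m\<phi>) auto
    show "integrable lebesgue (\<lambda>w. norm (P w))" using iP by simp
    show "AE w in lebesgue. norm (\<phi> n w *\<^sub>R P w) \<le> norm (P w)" for n
      using \<phi>01[of n] by (intro AE_I2) (simp add: mult_left_le_one_le)
    show "AE w in lebesgue. (\<lambda>n. \<phi> n w *\<^sub>R P w) \<longlonglongrightarrow> indicator (box a b) w *\<^sub>R P w"
    proof (intro AE_I2 tendsto_scaleR tendsto_const)
      fix w
      show "(\<lambda>n. \<phi> n w) \<longlonglongrightarrow> indicator (box a b) w"
      proof (cases "w \<in> box a b")
        case True
        then have c: "box_bump a b w > 0" using box_bump_pos_iff[OF ab(1)] by simp
        have "(\<lambda>n. real n * c / (1 + real n * c)) \<longlonglongrightarrow> 1" if "c > 0" for c :: real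
          using that by real_asymp
        then show ?thesis using c True by (simp add: \<phi>_def)
      next
        case False then show ?thesis using b0 by (simp add: \<phi>_def)
      qed
    qed
  qed
  then show ?thesis
    unfolding set_lebesgue_integral_def e2 \<phi>_def[symmetric] e1 .
qed

lemma set_integrable_of_locally_L2:
  assumes L2: "locally_L2 U p" and k: "compact k" "k \<subseteq> U"
  shows "set_integrable lebesgue k p"
proof -
  have m: "set_borel_measurable lebesgue k p" and i: "set_integrable lebesgue k (\<lambda>w. (cmod (p w))\<^sup>2)"
    using L2 k by (auto simp: locally_L2_def)
  have "integrable lebesgue (\<lambda>w. indicator k w *\<^sub>R (1::real))"
    using borel_integrable_compact[OF k(1), of "\<lambda>_. 1::real"]
    by (subst integrable_completion) (auto simp: compact_imp_closed k)
  then have "integrable lebesgue (\<lambda>w. indicator k w *\<^sub>R (1::real) + indicator k w *\<^sub>R (cmod (p w))\<^sup>2)"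
    using i by (intro Bochner_Integration.integrable_add) (auto simp: set_integrable_def)
  then show ?thesis
    unfolding set_integrable_def
  proof (rule Bochner_Integration.integrable_bound)
    show "(\<lambda>x. indicat_real k x *\<^sub>R p x) \<in> borel_measurable lebesgue"
      using m by (simp add: set_borel_measurable_def)
    \<comment> \<open>On a set of finite measure, square integrability gives integrability.\<close>
    have "t \<le> 1 + t\<^sup>2" for t :: real
    proof -
      have "(t - 1)\<^sup>2 = t\<^sup>2 - 2 * t + 1" by (simp add: power2_diff)
      then show ?thesis using zero_le_power2[of "t - 1"] zero_le_power2[of t] by linarith
    qed
    then show "AE x in lebesgue. norm (indicat_real k x *\<^sub>R p x)
         \<le> norm (indicat_real k x *\<^sub>R 1 + indicat_real k x *\<^sub>R (cmod (p x))\<^sup>2)"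
      by (intro AE_I2) (auto simp: indicator_def)
  qed
qed

text \<open>
  Weak derivatives are unique: both derivatives have the same integral over every small box.
\<close>

lemma weak_dir_deriv_AE_eq_classical:
  fixes f p :: "complex \<Rightarrow> complex"
  assumes U: "open U" and der: "\<And>w. w \<in> U \<Longrightarrow> (f has_derivative f' w) (at w)"
    and cont: "continuous_on U (\<lambda>w. f' w v)"
    and weak: "weak_dir_deriv U v f p" and L2: "locally_L2 U p" and ab: "cbox a b \<subseteq> U"
  shows "AE w in lebesgue. w \<in> box a b \<longrightarrow> p w = f' w v"
proof -
  have ip: "set_integrable lebesgue (cbox c d) p" if "cbox c d \<subseteq> U" for c d
    by (rule set_integrable_of_locally_L2[OF L2 compact_cbox that])
  have if': "set_integrable lebesgue (cbox c d) (\<lambda>w. f' w v)" if "cbox c d \<subseteq> U" for c d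
  proof -
    have c: "continuous_on (cbox c d) (\<lambda>w. f' w v)" using cont that by (rule continuous_on_subset)
    have i: "integrable lborel (\<lambda>w. indicator (cbox c d) w *\<^sub>R f' w v)"
      by (rule borel_integrable_compact[OF compact_cbox c])
    show ?thesis unfolding set_integrable_def
      using integrable_completion[OF borel_measurable_integrable[OF i]] i by blast
  qed
  have sub: "set_integrable lebesgue (box c d) u" if "set_integrable lebesgue (cbox c d) u" for c d and u :: "complex \<Rightarrow> complex"
    by (rule set_integrable_subset[OF that]) (auto simp: sets_completionI_sets box_subset_cbox)
  have "AE w in lebesgue. w \<in> box a b \<longrightarrow> p w - f' w v = 0"
  proof (rule AE_eq_0_of_box_integrals)
    show "set_integrable lebesgue (box a b) (\<lambda>w. p w - f' w v)"
      using sub[OF ip[OF ab]] sub[OF if'[OF ab]] by (rule set_integral_diff)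
    fix c d assume cd: "box c d \<noteq> {}" "cbox c d \<subseteq> cbox a b"
    then have cdU: "cbox c d \<subseteq> U" using ab by blast
    let ?\<phi> = "\<lambda>n w. real n * box_bump c d w / (1 + real n * box_bump c d w)"
    have "set_lebesgue_integral lebesgue U (\<lambda>w. ?\<phi> n w *\<^sub>R p w)
        = set_lebesgue_integral lebesgue U (\<lambda>w. ?\<phi> n w *\<^sub>R f' w v)" for n
      by (rule weak_dir_deriv_eq_classical[OF U der cont weak test_function_box_bump[OF cd(1) cdU]]) auto
    then have "set_lebesgue_integral lebesgue (box c d) p = set_lebesgue_integral lebesgue (box c d) (\<lambda>w. f' w v)"
      using LIMSEQ_unique[OF box_bump_integrals_tendsto[OF cd(1) cdU ip[OF cdU]]]
        box_bump_integrals_tendsto[OF cd(1) cdU if'[OF cdU]] by simp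
    then show "set_lebesgue_integral lebesgue (box c d) (\<lambda>w. p w - f' w v) = 0"
      using set_integral_diff(2)[OF sub[OF ip[OF cdU]] sub[OF if'[OF cdU]]] by simp
  qed
  then show ?thesis by simp
qed

section \<open>The distortion inequality for harmonic maps\<close>

lemma harmonic_has_derivative:
  assumes h: "h holomorphic_on unit_disk" and g: "g holomorphic_on unit_disk"
    and f: "\<And>z. z \<in> unit_disk \<Longrightarrow> f z = h z + cnj (g z)" and z: "z \<in> unit_disk"
  shows "(f has_derivative (\<lambda>v. deriv h z * v + cnj (deriv g z * v))) (at z)"
proof -
  have "(h has_derivative (\<lambda>v. deriv h z * v)) (at z)" "(g has_derivative (\<lambda>v. deriv g z * v)) (at z)"
    using holomorphic_derivI[OF h open_ball z] holomorphic_derivI[OF g open_ball z]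
    by (simp_all add: has_field_derivative_def)
  then have "((\<lambda>z. h z + cnj (g z)) has_derivative (\<lambda>v. deriv h z * v + cnj (deriv g z * v))) (at z)"
    by (auto intro!: derivative_eq_intros)
  then show ?thesis
    using has_derivative_transform_within_open[OF _ open_ball z] f by (metis (no_types, lifting))
qed

text \<open>
  For \<open>f = h + cnj g\<close> the Wirtinger derivatives are \<open>h'\<close> and \<open>cnj g'\<close>.  They are continuous, so
  the distortion inequality holds on a relatively closed set of full measure, that is, everywhere.
\<close>

lemma qc_harmonic_dilatation:
  fixes f :: "complex \<Rightarrow> complex"
  assumes qc: "quasiconformal_on K unit_disk f"
    and h: "h holomorphic_on unit_disk" and g: "g holomorphic_on unit_disk"
    and f: "\<And>z. z \<in> unit_disk \<Longrightarrow> f z = h z + cnj (g z)"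
    and z: "z \<in> unit_disk"
  shows "(cmod (deriv h z) + cmod (deriv g z))\<^sup>2 \<le> K * \<bar>(cmod (deriv h z))\<^sup>2 - (cmod (deriv g z))\<^sup>2\<bar>"
proof -
  obtain p q where pq: "has_W12_loc_partials unit_disk f p q"
    and dil: "AE w in lebesgue. w \<in> unit_disk \<longrightarrow> (D_norm (p w) (q w))\<^sup>2 \<le> K * \<bar>D_det (p w) (q w)\<bar>"
    using qc unfolding quasiconformal_on_def by blast
  define L where "L w v = deriv h w * v + cnj (deriv g w * v)" for w v
  have der: "(f has_derivative L w) (at w)" if "w \<in> unit_disk" for w
    unfolding L_def[abs_def] by (rule harmonic_has_derivative[OF h g f that])
  have ch: "continuous_on unit_disk (deriv h)" and cg: "continuous_on unit_disk (deriv g)"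
    using h g by (auto intro!: holomorphic_on_imp_continuous_on holomorphic_deriv)
  have cL: "continuous_on unit_disk (\<lambda>w. L w v)" for v
    unfolding L_def by (intro continuous_intros ch cg)
  obtain a b where ab: "cbox a b \<subseteq> unit_disk" "z \<in> box a b"
    using open_contains_cbox[OF open_ball z] by metis
  have p: "AE w in lebesgue. w \<in> box a b \<longrightarrow> p w = L w 1"
    using pq by (intro weak_dir_deriv_AE_eq_classical[OF open_ball der cL _ _ ab(1)])
      (auto simp: has_W12_loc_partials_def)
  have q: "AE w in lebesgue. w \<in> box a b \<longrightarrow> q w = L w \<i>"
    using pq by (intro weak_dir_deriv_AE_eq_classical[OF open_ball der cL _ _ ab(1)])
      (auto simp: has_W12_loc_partials_def)
  have wirt: "wirt_z (L w 1) (L w \<i>) = deriv h w" "wirt_zbar (L w 1) (L w \<i>) = cnj (deriv g w)" for w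
    by (simp_all add: wirt_z_def wirt_zbar_def L_def complex_eq_iff)
  define C where "C = {w \<in> cbox a b. (cmod (deriv h w) + cmod (deriv g w))\<^sup>2
      \<le> K * \<bar>(cmod (deriv h w))\<^sup>2 - (cmod (deriv g w))\<^sup>2\<bar>}"
  have "closed C" unfolding C_def
    by (intro continuous_on_closed_Collect_le continuous_intros closed_cbox
          continuous_on_subset[OF ch ab(1)] continuous_on_subset[OF cg ab(1)])
  moreover have "AE w in lebesgue. w \<in> box a b \<longrightarrow> w \<in> C"
    using p q dil
  proof eventually_elim
    case (elim w)
    then show ?case
      using ab(1) box_subset_cbox[of a b] by (auto simp: C_def D_norm_def D_det_def wirt)
  qed
  ultimately have "z \<in> C" using mem_closed_if_AE_lebesgue_open[OF open_box] ab(2) by blast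
  then show ?thesis by (simp add: C_def)
qed

section \<open>The length-area estimate\<close>

text \<open>
  The area formula for an injective map: the integral of the Jacobian is the area of the image, and
  the image lies in a square of side \<open>2 d\<close>.  The vectors \<open>P\<close> and \<open>Q\<close> are the partial derivatives
  of \<open>F\<close>.  The domain is \<open>real \<times> real\<close>, so that the left-hand side can be treated by Tonelli's
  theorem.
\<close>

lemma nn_integral_Jacobian_le:
  fixes F P Q :: "real \<times> real \<Rightarrow> complex"
  assumes S: "open S" and inj: "inj_on F S"
    and der: "\<And>x. x \<in> S \<Longrightarrow> (F has_derivative (\<lambda>(s, t). of_real s * P x + of_real t * Q x)) (at x)"
    and P: "continuous_on S P" and Q: "continuous_on S Q"
    and im: "F ` S \<subseteq> ball w d"
  shows "(\<integral>\<^sup>+x. ennreal \<bar>Re (P x) * Im (Q x) - Im (P x) * Re (Q x)\<bar> * indicator S x \<partial>lborel) \<le> ennreal (4 * d\<^sup>2)"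
proof (cases "S = {}")
  case False
  then have d: "d > 0" using im by (metis ball_eq_empty image_is_empty linorder_not_le subset_empty)
  define J where "J x = \<bar>Re (P x) * Im (Q x) - Im (P x) * Re (Q x)\<bar>" for x
  \<comment> \<open>The change of variables theorem concerns maps of \<open>real^2\<close> to itself, so \<open>F\<close> is conjugated by the
    measure-preserving identifications \<open>T\<close> and \<open>U\<close>.\<close>
  define T where "T v = (v $ 1, v $ 2)" for v :: "real^2"
  define U :: "complex \<Rightarrow> real^2" where "U z = vector [Re z, Im z]" for z
  define G where "G v = (U (F (T v)) :: real^2)" for v :: "real^2"
  define S' where "S' = T -` S"
  have linT: "linear T" unfolding T_def by (auto intro!: linearI)
  then have blT: "bounded_linear T" by (simp add: linear_conv_bounded_linear)
  have linU: "linear (U :: complex \<Rightarrow> real^2)"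
    unfolding U_def by (auto intro!: linearI simp: vec_eq_iff forall_2 vector_2)
  then have blU: "bounded_linear (U :: complex \<Rightarrow> real^2)" by (simp add: linear_conv_bounded_linear)
  have contT: "continuous_on UNIV T" by (rule linear_continuous_on[OF blT])
  have contU: "continuous_on X (U :: complex \<Rightarrow> real^2)" for X by (rule linear_continuous_on[OF blU])
  have injU: "inj (U :: complex \<Rightarrow> real^2)"
    unfolding U_def inj_def by (metis complex_eqI vector_2)
  have injT: "inj T" unfolding T_def inj_def by (auto simp: vec_eq_iff forall_2)
  have opS': "open S'" unfolding S'_def by (rule open_vimage[OF S contT])
  have injG: "inj_on G S'"
    unfolding G_def S'_def
    by (rule inj_onI) (use inj injT injU in \<open>auto simp: inj_on_def\<close>)
  define G' where "G' v = (\<lambda>x::real^2. U (of_real (x $ 1) * P (T v) + of_real (x $ 2) * Q (T v)))" for v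
  have derG: "(G has_derivative G' v) (at v within S')" if "v \<in> S'" for v
  proof -
    have 1: "(T has_derivative T) (at v within S')" by (rule bounded_linear_imp_has_derivative[OF blT])
    have 2: "(F has_derivative (\<lambda>(s, t). of_real s * P (T v) + of_real t * Q (T v))) (at (T v))"
      using der that by (auto simp: S'_def)
    have 3: "(U has_derivative (U :: complex \<Rightarrow> real^2)) (at (F (T v)))"
      by (rule bounded_linear_imp_has_derivative[OF blU])
    have "((\<lambda>v. F (T v)) has_derivative (\<lambda>x. (\<lambda>(s, t). of_real s * P (T v) + of_real t * Q (T v)) (T x))) (at v within S')"
      by (rule has_derivative_compose[OF 1 2])
    from has_derivative_compose[OF this 3] show ?thesis
      by (simp add: G_def[abs_def] G'_def T_def)
  qed
  have detG: "\<bar>det (matrix (G' v))\<bar> = J (T v)" for v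
    by (simp add: det_2 matrix_def G'_def U_def axis_def J_def vector_2 mult.commute)
  have contF: "continuous_on S F"
    by (intro continuous_at_imp_continuous_on ballI has_derivative_continuous[OF der])
  have contG: "continuous_on S' G"
    unfolding G_def
    by (rule continuous_on_compose2[OF contU[of UNIV] continuous_on_compose2[OF contF continuous_on_subset[OF contT]]])
       (auto simp: S'_def)
  have opG: "open (G ` S')"
    by (rule Further_Topology.invariance_of_domain_gen[OF opS' contG injG]) simp
  define c :: "real^2" where "c = U w"
  have sub: "G ` S' \<subseteq> cbox (c - vec d) (c + vec d)"
  proof
    fix y assume "y \<in> G ` S'"
    then obtain x where x: "x \<in> S" "y = U (F x)" by (auto simp: G_def S'_def)
    then have "cmod (F x - w) < d" using im by (force simp: dist_norm norm_minus_commute)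
    then have "\<bar>Re (F x) - Re w\<bar> < d" "\<bar>Im (F x) - Im w\<bar> < d"
      using abs_Re_le_cmod[of "F x - w"] abs_Im_le_cmod[of "F x - w"] by auto
    then show "y \<in> cbox (c - vec d) (c + vec d)"
      by (auto simp: mem_box_cart x c_def U_def forall_2 vector_2)
  qed
  have lm: "G ` S' \<in> lmeasurable"
    using sub opG by (meson bounded_cbox bounded_subset lmeasurable_open)
  have "measure lebesgue (G ` S') \<le> measure lebesgue (cbox (c - vec d) (c + vec d))"
    using sub lm by (intro measure_mono_fmeasurable) (auto simp: fmeasurableD)
  also have "\<dots> = 4 * d\<^sup>2"
    using d by (subst measure_completion, simp, subst content_cbox_cart) (auto simp: interval_ne_empty_cart forall_2 UNIV_2 power2_eq_square)
  finally have m: "measure lebesgue (G ` S') \<le> 4 * d\<^sup>2" .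
  have leb: "S' \<in> sets lebesgue" using opS' by (simp add: sets_completionI_sets)
  have "((\<lambda>x. \<bar>det (matrix (G' x))\<bar>) has_integral (measure lebesgue (G ` S'))) S'"
    using has_measure_differentiable_image[OF leb derG injG] lm by blast
  then have "(\<integral>\<^sup>+v. ennreal (J (T v)) * indicator S' v \<partial>lborel) = ennreal (measure lebesgue (G ` S'))"
    using nn_integral_has_integral_lebesgue'[of S' "\<lambda>v. J (T v)"] by (simp add: detG J_def)
  moreover have "(\<integral>\<^sup>+v. ennreal (J (T v)) * indicator S' v \<partial>lborel) = (\<integral>\<^sup>+x. ennreal (J x) * indicator S x \<partial>lborel)"
  proof -
    have mT: "T \<in> borel_measurable borel" using contT by (rule borel_measurable_continuous_onI)
    \<comment> \<open>\<open>T\<close> preserves the area of boxes, hence Lebesgue measure.\<close>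
    have L: "lborel = distr lborel borel T"
    proof (rule lborel_eqI)
      fix l u :: "real \<times> real" assume lu: "\<And>b. b \<in> Basis \<Longrightarrow> l \<bullet> b \<le> u \<bullet> b"
      have le: "fst l \<le> fst u" "snd l \<le> snd u"
        using lu[of "(1,0)"] lu[of "(0,1)"] by (cases l, cases u, auto simp: Basis_prod_def)+
      have "emeasure (distr lborel borel T) (box l u) = emeasure lborel (T -` box l u)"
        using mT by (subst emeasure_distr) auto
      also have "T -` box l u = box (vector [fst l, snd l]) (vector [fst u, snd u] :: real^2)"
        by (cases l; cases u) (auto simp: T_def mem_box_cart forall_2 vector_2 mem_box Basis_prod_def)
      also have "emeasure lborel \<dots> = ennreal (measure lborel (box (vector [fst l, snd l]) (vector [fst u, snd u] :: real^2)))"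
        by (intro emeasure_eq_ennreal_measure) (auto simp: emeasure_lborel_box_eq)
      also have "measure lborel (box (vector [fst l, snd l]) (vector [fst u, snd u] :: real^2))
          = measure lborel (cbox (vector [fst l, snd l]) (vector [fst u, snd u] :: real^2))"
        by (simp add: measure_lborel_box_eq measure_lborel_cbox_eq)
      also have "\<dots> = (fst u - fst l) * (snd u - snd l)"
        using le by (subst content_cbox_cart) (auto simp: interval_ne_empty_cart forall_2 UNIV_2 vector_2)
      also have "\<dots> = (\<Prod>b\<in>Basis. (u - l) \<bullet> b)"
        by (cases l; cases u) (simp add: Basis_prod_def prod.union_disjoint)
      finally show "emeasure (distr lborel borel T) (box l u) = ennreal (\<Prod>b\<in>Basis. (u - l) \<bullet> b)" .
    qed auto
    have cJ: "continuous_on S (\<lambda>x. J x)" unfolding J_def by (intro continuous_intros P Q)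
    have "(\<lambda>x. indicator S x *\<^sub>R J x) \<in> borel_measurable borel"
      by (rule borel_measurable_continuous_on_indicator[OF _ cJ]) (use S in auto)
    then have mJ: "(\<lambda>x. ennreal (indicator S x *\<^sub>R J x)) \<in> borel_measurable borel" by measurable
    have e: "ennreal (J x) * indicator S x = ennreal (indicator S x *\<^sub>R J x)" for x
      by (auto simp: indicator_def)
    have "(\<integral>\<^sup>+x. ennreal (J x) * indicator S x \<partial>lborel) = (\<integral>\<^sup>+x. ennreal (indicator S x *\<^sub>R J x) \<partial>(distr lborel borel T))"
      using L by (simp add: e)
    also have "\<dots> = (\<integral>\<^sup>+v. ennreal (indicator S (T v) *\<^sub>R J (T v)) \<partial>lborel)"
      using mT mJ by (subst nn_integral_distr) auto
    also have "\<dots> = (\<integral>\<^sup>+v. ennreal (J (T v)) * indicator S' v \<partial>lborel)"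
      by (intro nn_integral_cong) (auto simp: S'_def indicator_def)
    finally show ?thesis by simp
  qed
  ultimately have "(\<integral>\<^sup>+x. ennreal (J x) * indicator S x \<partial>lborel) = ennreal (measure lebesgue (G ` S'))"
    by simp
  also have "\<dots> \<le> ennreal (4 * d\<^sup>2)" using m by (rule ennreal_leI)
  finally show ?thesis by (simp only: J_def)
qed auto

lemma ball_bdry_dist_subset:
  assumes w: "w \<in> G"
  shows "ball w (bdry_dist G w) \<subseteq> G"
proof (rule ccontr)
  assume n: "\<not> ?thesis"
  then have "w \<in> ball w (bdry_dist G w)"
    by (metis ball_eq_empty centre_in_ball empty_subsetI linorder_not_le)
  with n have "ball w (bdry_dist G w) \<inter> frontier G \<noteq> {}"
    using w by (intro connected_Int_frontier) fastforce+
  then obtain x where "x \<in> frontier G" "dist w x < bdry_dist G w" by auto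
  then show False using infdist_le[of x "frontier G" w] by (simp add: bdry_dist_def)
qed

text \<open>
  The Cauchy-Schwarz inequality on an interval, obtained by integrating the square of
  \<open>\<phi> - m / T\<close>.
\<close>

lemma L2_lower_bound:
  fixes \<phi> :: "real \<Rightarrow> real"
  assumes T: "0 < T" and c: "continuous_on {0..T} \<phi>" and m: "0 \<le> m" "m \<le> integral {0..T} \<phi>"
  shows "m\<^sup>2 / T \<le> integral {0..T} (\<lambda>t. (\<phi> t)\<^sup>2)"
proof -
  have i2: "(\<lambda>t. (\<phi> t)\<^sup>2) integrable_on {0..T}"
    using c by (auto intro!: integrable_continuous_real continuous_intros)
  define k where "k = m / T"
  have k: "k \<ge> 0" using m T by (simp add: k_def)
  have i3: "(\<lambda>t. (2 * k) * \<phi> t) integrable_on {0..T}"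
    using c by (intro integrable_continuous_real continuous_intros)
  have "0 \<le> integral {0..T} (\<lambda>t. (\<phi> t - k)\<^sup>2)"
    using c by (intro integral_nonneg integrable_continuous_real continuous_intros) auto
  also have "(\<lambda>t. (\<phi> t - k)\<^sup>2) = (\<lambda>t. ((\<phi> t)\<^sup>2 - (2 * k) * \<phi> t) + k\<^sup>2)"
    by (auto simp: power2_diff)
  also have "integral {0..T} \<dots> = integral {0..T} (\<lambda>t. (\<phi> t)\<^sup>2) - (2 * k) * integral {0..T} \<phi> + k\<^sup>2 * T"
    using T by (simp add: integral_add[OF integrable_diff[OF i2 i3]] integral_diff[OF i2 i3] integrable_const_ivl)
  also have "\<dots> \<le> integral {0..T} (\<lambda>t. (\<phi> t)\<^sup>2) - (2 * k) * m + k\<^sup>2 * T"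
    using m k by (intro add_right_mono diff_left_mono mult_left_mono) auto
  also have "\<dots> = integral {0..T} (\<lambda>t. (\<phi> t)\<^sup>2) - m\<^sup>2 / T"
    using T by (simp add: k_def power2_eq_square field_simps)
  finally show ?thesis by simp
qed

text \<open>
  The real-linear map \<open>v \<mapsto> a v + cnj (b v)\<close> multiplies areas by the factor
  \<open>\<bar>a\<bar>\<^sup>2 - \<bar>b\<bar>\<^sup>2\<close>.
\<close>

lemma det_harmonic:
  "\<bar>Re (a * u + cnj (b * u)) * Im (a * v + cnj (b * v)) - Im (a * u + cnj (b * u)) * Re (a * v + cnj (b * v))\<bar>
    = \<bar>(cmod a)\<^sup>2 - (cmod b)\<^sup>2\<bar> * \<bar>Re u * Im v - Im u * Re v\<bar>"
proof -
  have "Re (a * u + cnj (b * u)) * Im (a * v + cnj (b * v)) - Im (a * u + cnj (b * u)) * Re (a * v + cnj (b * v))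
    = ((cmod a)\<^sup>2 - (cmod b)\<^sup>2) * (Re u * Im v - Im u * Re v)"
    unfolding cmod_power2 by (simp add: algebra_simps power2_eq_square)
  then show ?thesis by (simp add: abs_mult)
qed

text \<open>
  The length-area argument.  The hyperbolic length of the radial segment from \<open>(1 - s) e\<close> to
  \<open>(1 - l s) e\<close> is comparable to \<open>ln (1 / l)\<close>.  If \<open>f\<close> keeps the segment inside
  \<open>ball w (d / 2)\<close>, while \<open>f\<close> leaves \<open>ball w (3 d / 4)\<close> on the way from the segment to the circle,
  then the Dirichlet integral of \<open>f\<close> over the preimage of \<open>ball w d\<close> is at least proportional to
  \<open>d\<^sup>2 ln (1 / l)\<close>.  As \<open>f\<close> is injective and has dilatation at most \<open>K\<close>, this integral is also at
  most proportional to \<open>K d\<^sup>2\<close>.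
\<close>

lemma log_length_le_of_small_radial_oscillation:
  fixes f :: "complex \<Rightarrow> complex"
  assumes h: "h holomorphic_on unit_disk" and g: "g holomorphic_on unit_disk"
    and f: "\<And>z. z \<in> unit_disk \<Longrightarrow> f z = h z + cnj (g z)"
    and inj: "inj_on f unit_disk"
    and K: "\<And>z. z \<in> unit_disk \<Longrightarrow> (cmod (deriv h z) + cmod (deriv g z))\<^sup>2 \<le> K * ((cmod (deriv h z))\<^sup>2 - (cmod (deriv g z))\<^sup>2)"
    and K0: "K \<ge> 1"
    and e: "cmod e = 1" and s: "0 < s" "s \<le> 1" and l: "0 < l" "l < 1"
    and w: "ball w d \<subseteq> f ` unit_disk" and d: "0 < d"
    and near: "\<And>\<sigma>. l * s \<le> \<sigma> \<Longrightarrow> \<sigma> \<le> s \<Longrightarrow> cmod (f (of_real (1 - \<sigma>) * e) - w) < d / 2"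
  shows "ln (1 / l) \<le> 128 * K"
proof -
  \<comment> \<open>Area-preserving coordinates: \<open>\<sigma>\<close> fixes the point \<open>(1 - \<sigma>) e\<close> on the radius, and \<open>\<tau>\<close> runs
    along the line through it in direction \<open>e (1 + \<i>)\<close>.  This line leaves the disk before
    \<open>\<tau> = \<sigma>\<close>, where it arrives at \<open>e (1 + \<i> \<sigma>)\<close>.\<close>
  define Z where "Z = (\<lambda>(\<sigma>, \<tau>). e * Complex (1 - \<sigma> + \<tau>) \<tau>)"
  define \<phi> where "\<phi> z = cmod (deriv h z) + cmod (deriv g z)" for z
  define L where "L z v = deriv h z * v + cnj (deriv g z * v)" for z v
  have derf: "(f has_derivative L z) (at z)" if "z \<in> unit_disk" for z
    unfolding L_def[abs_def] by (rule harmonic_has_derivative[OF h g f that])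
  have contf: "continuous_on unit_disk f"
    by (intro continuous_at_imp_continuous_on ballI has_derivative_continuous[OF derf])
  have conth': "continuous_on unit_disk (deriv h)" and contg': "continuous_on unit_disk (deriv g)"
    using h g by (auto intro!: holomorphic_on_imp_continuous_on holomorphic_deriv)
  have cont\<phi>: "continuous_on unit_disk \<phi>" unfolding \<phi>_def by (intro continuous_intros conth' contg')
  have Z_alt: "Z = (\<lambda>x. e * (of_real (1 - fst x + snd x) + \<i> * of_real (snd x)))"
    by (auto simp: Z_def fun_eq_iff complex_eq_iff)
  have contZ: "continuous_on A Z" for A
    unfolding Z_alt by (intro continuous_intros)
  have normZ: "cmod (Z (\<sigma>, \<tau>)) = cmod (Complex (1 - \<sigma> + \<tau>) \<tau>)" for \<sigma> \<tau>
    using e by (simp add: Z_def norm_mult)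
  have derZ: "(Z has_derivative (\<lambda>(a, b). of_real a * (- e) + of_real b * (e * (1 + \<i>)))) (at x)" for x
    unfolding Z_alt by (auto intro!: derivative_eq_intros simp: fun_eq_iff algebra_simps)
  have injZ: "inj Z"
  proof (rule injI)
    fix x y assume "Z x = Z y"
    then have "Complex (1 - fst x + snd x) (snd x) = Complex (1 - fst y + snd y) (snd y)"
      using e by (auto simp: Z_def split_beta)
    then show "x = y" by (auto simp: prod_eq_iff)
  qed
  define V where "V = unit_disk \<inter> f -` ball w d"
  have opV: "open V" unfolding V_def
    by (rule continuous_open_preimage[OF contf open_ball open_ball])
  define S where "S = ({l * s<..<s} \<times> UNIV) \<inter> Z -` V"
  have opS: "open S" unfolding S_def
    by (intro open_Int open_Times open_vimage[OF opV contZ]) auto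
  have SD: "Z x \<in> unit_disk" if "x \<in> S" for x using that by (auto simp: S_def V_def)
  define J where "J z = (cmod (deriv h z))\<^sup>2 - (cmod (deriv g z))\<^sup>2" for z
  have "(\<integral>\<^sup>+x. ennreal \<bar>Re (L (Z x) (- e)) * Im (L (Z x) (e * (1 + \<i>))) - Im (L (Z x) (- e)) * Re (L (Z x) (e * (1 + \<i>)))\<bar>
            * indicator S x \<partial>lborel) \<le> ennreal (4 * d\<^sup>2)"
  proof (rule nn_integral_Jacobian_le[where F = "\<lambda>x. f (Z x)" and w = w])
    show "inj_on (\<lambda>x. f (Z x)) S"
      by (rule inj_onI) (metis SD inj injZ inj_onD injD)
    show "(\<lambda>x. f (Z x)) ` S \<subseteq> ball w d" by (auto simp: S_def V_def)
    fix x assume x: "x \<in> S"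
    have "((\<lambda>x. f (Z x)) has_derivative (\<lambda>y. L (Z x) ((\<lambda>(a, b). of_real a * (- e) + of_real b * (e * (1 + \<i>))) y))) (at x)"
      by (rule has_derivative_compose[OF derZ derf[OF SD[OF x]]])
    then show "((\<lambda>x. f (Z x)) has_derivative (\<lambda>(a, b). of_real a * L (Z x) (- e) + of_real b * L (Z x) (e * (1 + \<i>)))) (at x)"
      by (rule has_derivative_eq_rhs) (auto simp: L_def fun_eq_iff algebra_simps)
  next
    have c: "continuous_on S (\<lambda>x. deriv h (Z x))" "continuous_on S (\<lambda>x. deriv g (Z x))"
      using SD by (auto intro!: continuous_on_compose2[OF conth' contZ] continuous_on_compose2[OF contg' contZ])
    show "continuous_on S (\<lambda>x. L (Z x) (- e))" "continuous_on S (\<lambda>x. L (Z x) (e * (1 + \<i>)))"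
      unfolding L_def by (intro continuous_intros c)+
  qed (use opS in auto)
  moreover have "\<bar>Re (L (Z x) (- e)) * Im (L (Z x) (e * (1 + \<i>))) - Im (L (Z x) (- e)) * Re (L (Z x) (e * (1 + \<i>)))\<bar>
      = \<bar>J (Z x)\<bar>" for x
  proof -
    have "Re (- e) * Im (e * (1 + \<i>)) - Im (- e) * Re (e * (1 + \<i>)) = - ((Re e)\<^sup>2 + (Im e)\<^sup>2)"
      by (simp add: algebra_simps power2_eq_square)
    also have "\<dots> = -1" using e by (simp add: cmod_power2[symmetric])
    finally show ?thesis unfolding L_def det_harmonic by (simp add: J_def)
  qed
  ultimately have area: "(\<integral>\<^sup>+x. ennreal \<bar>J (Z x)\<bar> * indicator S x \<partial>lborel) \<le> ennreal (4 * d\<^sup>2)"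
    by simp
  have \<phi>J: "(\<phi> (Z x))\<^sup>2 \<le> K * \<bar>J (Z x)\<bar>" if "x \<in> S" for x
  proof -
    have "(\<phi> (Z x))\<^sup>2 \<le> K * J (Z x)" using K[OF SD[OF that]] by (simp add: \<phi>_def J_def)
    also have "\<dots> \<le> K * \<bar>J (Z x)\<bar>" using K0 by (intro mult_left_mono) auto
    finally show ?thesis .
  qed
  define \<Phi> where "\<Phi> x = ennreal (indicator S x *\<^sub>R (\<phi> (Z x))\<^sup>2)" for x
  have m\<Phi>: "\<Phi> \<in> borel_measurable borel"
  proof -
    have "continuous_on S (\<lambda>x. (\<phi> (Z x))\<^sup>2)"
      using SD by (intro continuous_intros continuous_on_compose2[OF cont\<phi> contZ]) auto
    then have "(\<lambda>x. indicator S x *\<^sub>R (\<phi> (Z x))\<^sup>2) \<in> borel_measurable borel"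
      using opS by (intro borel_measurable_continuous_on_indicator) auto
    then show ?thesis unfolding \<Phi>_def[abs_def] by measurable
  qed
  have "(\<integral>\<^sup>+x. \<Phi> x \<partial>lborel) \<le> (\<integral>\<^sup>+x. ennreal K * (ennreal \<bar>J (Z x)\<bar> * indicator S x) \<partial>lborel)"
    using \<phi>J K0 by (intro nn_integral_mono) (auto simp: \<Phi>_def indicator_def ennreal_mult[symmetric] intro!: ennreal_leI)
  also have "\<dots> = ennreal K * (\<integral>\<^sup>+x. ennreal \<bar>J (Z x)\<bar> * indicator S x \<partial>lborel)"
  proof (rule nn_integral_cmult)
    have "continuous_on S (\<lambda>x. \<bar>J (Z x)\<bar>)" unfolding J_def
      using SD by (intro continuous_intros continuous_on_compose2[OF conth' contZ] continuous_on_compose2[OF contg' contZ]) auto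
    then have "(\<lambda>x. indicator S x *\<^sub>R \<bar>J (Z x)\<bar>) \<in> borel_measurable borel"
      using opS by (intro borel_measurable_continuous_on_indicator) auto
    then have "(\<lambda>x. ennreal (indicator S x *\<^sub>R \<bar>J (Z x)\<bar>)) \<in> borel_measurable borel" by measurable
    also have "(\<lambda>x. ennreal (indicator S x *\<^sub>R \<bar>J (Z x)\<bar>)) = (\<lambda>x. ennreal \<bar>J (Z x)\<bar> * indicator S x)"
      by (auto simp: indicator_def fun_eq_iff)
    finally show "(\<lambda>x. ennreal \<bar>J (Z x)\<bar> * indicator S x) \<in> borel_measurable lborel" by simp
  qed
  also have "\<dots> \<le> ennreal K * ennreal (4 * d\<^sup>2)" using area by (intro mult_left_mono) auto
  also have "\<dots> = ennreal (4 * K * d\<^sup>2)" using K0 by (simp add: ennreal_mult[symmetric] mult_ac)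
  finally have upper: "(\<integral>\<^sup>+x. \<Phi> x \<partial>lborel) \<le> ennreal (4 * K * d\<^sup>2)" .

  \<comment> \<open>\<open>f\<close> is a homeomorphism onto its image, so the points sent to \<open>cball w (3 d / 4)\<close> form a compact
    subset of the disk.\<close>
  obtain f' where hom: "homeomorphism unit_disk (f ` unit_disk) f f'"
    using Further_Topology.invariance_of_domain_homeomorphism[OF open_ball contf _ inj] by auto
  define Q where "Q = f' ` cball w (3 * d / 4)"
  have cb: "cball w (3 * d / 4) \<subseteq> f ` unit_disk"
    using w d by (intro order_trans[OF _ w]) auto
  have compQ: "compact Q" unfolding Q_def
    using hom cb by (intro compact_continuous_image) (auto simp: homeomorphism_def elim: continuous_on_subset)
  have Q_iff: "z \<in> Q \<longleftrightarrow> z \<in> unit_disk \<and> cmod (f z - w) \<le> 3 * d / 4" for z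
  proof
    assume "z \<in> Q"
    then obtain y where y: "y \<in> cball w (3 * d / 4)" "z = f' y" by (auto simp: Q_def)
    then have "y \<in> f ` unit_disk" using cb by blast
    then have "f z = y" "z \<in> unit_disk" using hom y by (auto simp: homeomorphism_def)
    then show "z \<in> unit_disk \<and> cmod (f z - w) \<le> 3 * d / 4"
      using y by (auto simp: dist_norm norm_minus_commute)
  next
    assume z: "z \<in> unit_disk \<and> cmod (f z - w) \<le> 3 * d / 4"
    then have "f' (f z) = z" using hom by (auto simp: homeomorphism_def)
    moreover have "f z \<in> cball w (3 * d / 4)" using z by (auto simp: dist_norm norm_minus_commute)
    ultimately show "z \<in> Q" unfolding Q_def by (metis imageI)
  qed

  have lower: "ennreal (d\<^sup>2 / (32 * \<sigma>)) \<le> (\<integral>\<^sup>+\<tau>. \<Phi> (\<sigma>, \<tau>) \<partial>lborel)" if \<sigma>: "l * s < \<sigma>" "\<sigma> < s" for \<sigma>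
  proof -
    have \<sigma>0: "0 < \<sigma>" "\<sigma> < 1" using \<sigma> l s by (auto intro: less_trans[of _ "l * s"])
    define z where "z \<tau> = Z (\<sigma>, \<tau>)" for \<tau>
    have contz: "continuous_on A z" for A
      unfolding z_def by (rule continuous_on_compose2[OF contZ[of UNIV]]) (auto intro!: continuous_intros)
    have z0: "z 0 = of_real (1 - \<sigma>) * e" by (simp add: z_def Z_def complex_of_real_def)
    have near0: "cmod (f (z 0) - w) < d / 2" using near[of \<sigma>] \<sigma> z0 by simp
    have z0D: "z 0 \<in> unit_disk" using e \<sigma>0 by (simp add: z0 norm_mult del: of_real_diff)
    define U where "U = unit_disk \<inter> f -` ball w (3 * d / 4)"
    have opU: "open U" unfolding U_def
      by (rule continuous_open_preimage[OF contf open_ball open_ball])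
    define E where "E = {0..} \<inter> z -` (- U)"
    have clE: "closed E" unfolding E_def
      using opU by (intro closed_Int closed_vimage contz) auto
    have "1 \<le> cmod (z \<sigma>)"
      unfolding z_def normZ by (simp add: cmod_def)
    then have \<sigma>E: "\<sigma> \<in> E" using \<sigma>0 by (auto simp: E_def U_def)
    have bE: "bdd_below E" by (auto simp: E_def bdd_below_def)
    \<comment> \<open>\<open>T\<close> is the first time at which the line leaves the preimage of \<open>ball w (3 d / 4)\<close>.  Up to that
      time it stays in the compact set \<open>Q\<close>, so it is still inside the disk at time \<open>T\<close>, and the
      distance of \<open>f\<close> from \<open>w\<close> has grown from less than \<open>d / 2\<close> to at least \<open>3 d / 4\<close>.\<close>
    define T where "T = Inf E"
    have TE: "T \<in> E" unfolding T_def using clE \<sigma>E bE by (intro closed_contains_Inf) auto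
    have T\<sigma>: "T \<le> \<sigma>" unfolding T_def using \<sigma>E bE by (intro cInf_lower)
    have z0U: "z 0 \<in> U" using near0 z0D d by (auto simp: U_def dist_norm norm_minus_commute)
    have T0: "0 < T" using TE z0U by (cases "T = 0") (auto simp: E_def)
    have inU: "z \<tau> \<in> U" if "0 \<le> \<tau>" "\<tau> < T" for \<tau>
    proof (rule ccontr)
      assume "z \<tau> \<notin> U"
      then have "\<tau> \<in> E" using that by (auto simp: E_def)
      then have "T \<le> \<tau>" unfolding T_def using bE by (intro cInf_lower)
      then show False using that by simp
    qed
    have inQ: "z \<tau> \<in> Q" if "0 \<le> \<tau>" "\<tau> < T" for \<tau>
      using inU[OF that] by (auto simp: Q_iff U_def dist_norm norm_minus_commute)
    have "closure {0..<T} \<subseteq> z -` Q"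
      using inQ by (intro closure_minimal closed_vimage contz compact_imp_closed[OF compQ]) auto
    then have inQ': "z \<tau> \<in> Q" if "\<tau> \<in> {0..T}" for \<tau>
      using that T0 by auto
    then have inD: "z \<tau> \<in> unit_disk" if "\<tau> \<in> {0..T}" for \<tau> using that Q_iff by blast
    have far: "3 * d / 4 \<le> cmod (f (z T) - w)"
      using TE inD[of T] T0 by (auto simp: E_def U_def dist_norm norm_minus_commute)
    have gap: "d / 4 \<le> cmod (f (z T) - f (z 0))"
      using far near0 norm_triangle_ineq4[of "f (z T) - f (z 0)" "w - f (z 0)"]
      by (simp add: norm_minus_commute)
    have derz: "(z has_vector_derivative (e * (1 + \<i>))) (at \<tau> within {0..T})" for \<tau>
      unfolding z_def Z_alt by (auto intro!: derivative_eq_intros simp: algebra_simps)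
    have derfz: "((\<lambda>\<tau>. f (z \<tau>)) has_vector_derivative (L (z \<tau>) (e * (1 + \<i>)))) (at \<tau> within {0..T})"
      if "\<tau> \<in> {0..T}" for \<tau>
    proof -
      have "((\<lambda>\<tau>. f (z \<tau>)) has_derivative (\<lambda>x. L (z \<tau>) (x *\<^sub>R (e * (1 + \<i>))))) (at \<tau> within {0..T})"
        by (rule has_derivative_compose[OF derz[unfolded has_vector_derivative_def] derf[OF inD[OF that]]])
      moreover have "L (z \<tau>) (x *\<^sub>R v) = x *\<^sub>R L (z \<tau>) v" for x v
        by (simp add: L_def algebra_simps)
      ultimately show ?thesis by (simp add: has_vector_derivative_def)
    qed
    have int: "((\<lambda>\<tau>. L (z \<tau>) (e * (1 + \<i>))) has_integral (f (z T) - f (z 0))) {0..T}"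
      using T0 derfz by (intro fundamental_theorem_of_calculus) auto
    have cont\<phi>z: "continuous_on {0..T} (\<lambda>\<tau>. \<phi> (z \<tau>))"
      using inD by (intro continuous_on_compose2[OF cont\<phi> contz]) auto
    have Lb: "cmod (L (z \<tau>) (e * (1 + \<i>))) \<le> sqrt 2 * \<phi> (z \<tau>)" for \<tau>
    proof -
      have "cmod (1 + \<i>) = sqrt 2" by (simp add: cmod_def)
      then have "cmod (e * (1 + \<i>)) = sqrt 2" using e by (simp add: norm_mult)
      moreover have "cmod (L (z \<tau>) v) \<le> \<phi> (z \<tau>) * cmod v" for v
        unfolding L_def \<phi>_def
        by (rule order_trans[OF norm_triangle_ineq]) (simp add: norm_mult algebra_simps)
      ultimately show ?thesis by (metis mult.commute)
    qed
    have "cmod (f (z T) - f (z 0)) = cmod (integral {0..T} (\<lambda>\<tau>. L (z \<tau>) (e * (1 + \<i>))))"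
      using int by (simp add: integral_unique)
    also have "\<dots> \<le> integral {0..T} (\<lambda>\<tau>. sqrt 2 * \<phi> (z \<tau>))"
      by (intro integral_norm_bound_integral has_integral_integrable[OF int] integrable_continuous_real
            continuous_intros cont\<phi>z Lb)
    finally have "d / 4 \<le> sqrt 2 * integral {0..T} (\<lambda>\<tau>. \<phi> (z \<tau>))" using gap by simp
    then have m: "d / (4 * sqrt 2) \<le> integral {0..T} (\<lambda>\<tau>. \<phi> (z \<tau>))"
      by (simp add: field_simps)
    have "(d / (4 * sqrt 2))\<^sup>2 / T \<le> integral {0..T} (\<lambda>\<tau>. (\<phi> (z \<tau>))\<^sup>2)"
      using L2_lower_bound[OF T0 cont\<phi>z _ m] d by simp
    also have "(d / (4 * sqrt 2))\<^sup>2 / T = d\<^sup>2 / (32 * T)" by (simp add: power_divide power_mult_distrib)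
    finally have 1: "d\<^sup>2 / (32 * T) \<le> integral {0..T} (\<lambda>\<tau>. (\<phi> (z \<tau>))\<^sup>2)" .
    have "d\<^sup>2 / (32 * \<sigma>) \<le> d\<^sup>2 / (32 * T)" using T0 T\<sigma> \<sigma>0 by (intro divide_left_mono) auto
    with 1 have "ennreal (d\<^sup>2 / (32 * \<sigma>)) \<le> ennreal (integral {0..T} (\<lambda>\<tau>. (\<phi> (z \<tau>))\<^sup>2))"
      by (intro ennreal_leI) simp
    also have "\<dots> = (\<integral>\<^sup>+\<tau>. ennreal ((\<phi> (z \<tau>))\<^sup>2) * indicator {0..T} \<tau> \<partial>lborel)"
      using cont\<phi>z by (intro nn_integral_has_integral_lebesgue'[symmetric])
        (auto intro!: integrable_integral integrable_continuous_real continuous_intros)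
    also have "\<dots> \<le> (\<integral>\<^sup>+\<tau>. \<Phi> (\<sigma>, \<tau>) \<partial>lborel)"
    proof (rule nn_integral_mono)
      fix \<tau>
      have "(\<sigma>, \<tau>) \<in> S" if "\<tau> \<in> {0..T}"
        using inQ'[OF that] \<sigma> d by (auto simp: S_def V_def Q_iff z_def dist_norm norm_minus_commute)
      then show "ennreal ((\<phi> (z \<tau>))\<^sup>2) * indicator {0..T} \<tau> \<le> \<Phi> (\<sigma>, \<tau>)"
        by (auto simp: indicator_def \<Phi>_def z_def)
    qed
    finally show ?thesis .
  qed

  have ls: "0 < l * s" "l * s < s" using l s by auto
  have "ennreal (d\<^sup>2 / 32 * ln s - d\<^sup>2 / 32 * ln (l * s)) = (\<integral>\<^sup>+\<sigma>. ennreal (d\<^sup>2 / (32 * \<sigma>)) * indicator {l * s..s} \<sigma> \<partial>lborel)"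
    using ls s
    by (intro nn_integral_FTC_Icc[symmetric, where F="\<lambda>\<sigma>. d\<^sup>2 / 32 * ln \<sigma>"]) (auto intro!: derivative_eq_intros simp: field_simps)
  also have "\<dots> \<le> (\<integral>\<^sup>+\<sigma>. (\<integral>\<^sup>+\<tau>. \<Phi> (\<sigma>, \<tau>) \<partial>lborel) \<partial>lborel)"
  proof (rule nn_integral_mono_AE)
    have "AE \<sigma> in lborel. \<sigma> \<notin> {l * s, s}" by (rule AE_not_in) (simp add: finite_imp_null_set_lborel)
    then show "AE \<sigma> in lborel. ennreal (d\<^sup>2 / (32 * \<sigma>)) * indicator {l * s..s} \<sigma> \<le> (\<integral>\<^sup>+\<tau>. \<Phi> (\<sigma>, \<tau>) \<partial>lborel)"
    proof eventually_elim
      case (elim \<sigma>)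
      then show ?case using lower[of \<sigma>] by (auto simp: indicator_def)
    qed
  qed
  also have "\<dots> = (\<integral>\<^sup>+x. \<Phi> x \<partial>lborel)"
    using lborel.nn_integral_fst[of \<Phi> lborel] m\<Phi> by (simp add: lborel_prod)
  also note upper
  finally have "d\<^sup>2 / 32 * ln s - d\<^sup>2 / 32 * ln (l * s) \<le> 4 * K * d\<^sup>2"
    using K0 by (simp add: ennreal_le_iff)
  moreover have "d\<^sup>2 / 32 * ln s - d\<^sup>2 / 32 * ln (l * s) = d\<^sup>2 * (ln (1 / l) / 32)"
    using l s by (simp add: ln_mult ln_div field_simps)
  ultimately have "d\<^sup>2 * (ln (1 / l) / 32) \<le> d\<^sup>2 * (4 * K)" by (simp add: mult_ac)
  then have "ln (1 / l) / 32 \<le> 4 * K" using d by simp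
  then show ?thesis by simp
qed

section \<open>Decay along the radii of a John disk\<close>

text \<open>
  Every partition of \<open>[b, c]\<close> becomes a partition of \<open>[a, c]\<close> when \<open>a\<close> and \<open>b\<close> are put in front.
\<close>

lemma curve_length_prepend:
  assumes "a \<le> b" "b \<le> c"
  shows "ennreal (dist (p a) (p b)) + curve_length p b c \<le> curve_length p a c"
proof -
  let ?I = "\<lambda>a. {(n :: nat, t :: nat \<Rightarrow> real). mono_on {..n} t \<and> t ` {..n} \<subseteq> {a..c}}"
  let ?S = "\<lambda>(n, t). \<Sum>i<n. ennreal (dist (p (t i)) (p (t (Suc i))))"
  have ne: "?I b \<noteq> {}"
  proof -
    have "(0, \<lambda>_. b) \<in> ?I b" using assms by (auto simp: mono_on_def)
    then show ?thesis by blast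
  qed
  have "ennreal (dist (p a) (p b)) + ?S x \<le> (SUP x \<in> ?I a. ?S x)" if "x \<in> ?I b" for x
  proof -
    obtain n t where x: "x = (n, t)" by (cases x)
    have t: "mono_on {..n} t" "\<And>i. i \<le> n \<Longrightarrow> b \<le> t i \<and> t i \<le> c" using that by (auto simp: x image_subset_iff)
    define t' where "t' i = (case i of 0 \<Rightarrow> a | Suc j \<Rightarrow> (case j of 0 \<Rightarrow> b | Suc k \<Rightarrow> t k))" for i
    have t'simps: "t' 0 = a" "t' (Suc 0) = b" "t' (Suc (Suc k)) = t k" for k
      by (simp_all add: t'_def)
    have "mono_on {..Suc (Suc n)} t'"
    proof (rule mono_onI)
      fix i j assume ij: "i \<in> {..Suc (Suc n)}" "j \<in> {..Suc (Suc n)}" "i \<le> j"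
      then show "t' i \<le> t' j"
        using assms t by (auto simp: t'_def mono_on_def split: nat.split) (meson order_trans)+
    qed
    moreover have "t' ` {..Suc (Suc n)} \<subseteq> {a..c}"
      using assms t by (auto simp: t'_def split: nat.split) (meson order_trans)
    ultimately have "(Suc (Suc n), t') \<in> ?I a" by auto
    then have "?S (Suc (Suc n), t') \<le> (SUP x \<in> ?I a. ?S x)" by (rule SUP_upper)
    moreover have "?S (Suc (Suc n), t') = ennreal (dist (p a) (p b)) + (ennreal (dist (p b) (p (t 0))) + ?S x)"
      unfolding x split sum.lessThan_Suc_shift t'simps by simp
    moreover have "ennreal (dist (p a) (p b)) + ?S x \<le> ennreal (dist (p a) (p b)) + (ennreal (dist (p b) (p (t 0))) + ?S x)"
      by (intro add_left_mono) (simp add: add_increasing)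
    ultimately show ?thesis by (metis (no_types, lifting) order_trans)
  qed
  then have "(SUP x \<in> ?I b. ennreal (dist (p a) (p b)) + ?S x) \<le> (SUP x \<in> ?I a. ?S x)"
    by (rule SUP_least)
  then show ?thesis
    unfolding curve_length_def by (simp add: ennreal_SUP_add_right[OF ne])
qed

lemma ex_power_bracket:
  fixes l y :: real
  assumes "0 < l" "l < 1" "0 < y" "y \<le> 1"
  shows "\<exists>j. l ^ Suc j < y \<and> y \<le> l ^ j"
proof -
  obtain n where n: "l ^ n < y" using real_arch_pow_inv assms by blast
  define m where "m = (LEAST n. l ^ n < y)"
  have m: "l ^ m < y" unfolding m_def using n by (rule LeastI)
  then obtain j where j: "m = Suc j" using assms by (cases m) auto
  have "\<not> l ^ j < y" using j not_less_Least[of j "\<lambda>n. l ^ n < y"] by (simp add: m_def)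
  then show ?thesis using m j by (intro exI[of _ j]) auto
qed

text \<open>
  Let \<open>\<Lambda>\<close> be the length of the remaining arc.  In passing from \<open>1 - s\<close> to \<open>1 - l s\<close> the curve moves
  by at least \<open>d / 2\<close>, and \<open>\<Lambda> \<le> c d\<close>, so \<open>\<Lambda>\<close> drops at least by the factor \<open>q = 1 - 1 / (2 c)\<close>.
  After \<open>j\<close> such steps \<open>\<Lambda>\<close> is at most a multiple of \<open>q ^ j\<close>, and this is at most
  \<open>(l ^ j) powr \<delta>\<close> if \<open>\<delta> \<le> ln q / ln l\<close>.
\<close>

lemma radial_Hoelder_of_John:
  fixes f :: "complex \<Rightarrow> complex" and \<Omega> :: "complex set"
  assumes c: "c \<ge> 1" and l: "0 < l" "l < 1"
    and John: "\<And>z t. z \<in> unit_disk \<Longrightarrow> 0 \<le> t \<Longrightarrow> t \<le> 1 \<Longrightarrow>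
        curve_length (\<lambda>s. f (of_real s * z)) t 1 \<le> ennreal (c * bdry_dist \<Omega> (f (of_real t * z)))"
    and step: "\<And>e s. cmod e = 1 \<Longrightarrow> 0 < s \<Longrightarrow> s \<le> 1 \<Longrightarrow> \<exists>\<sigma>. l * s \<le> \<sigma> \<and> \<sigma> \<le> s \<and>
        bdry_dist \<Omega> (f (of_real (1 - s) * e)) / 2 \<le> cmod (f (of_real (1 - \<sigma>) * e) - f (of_real (1 - s) * e))"
  shows "\<exists>C>0. \<exists>\<delta>. 0 < \<delta> \<and> \<delta> < 1 \<and> (\<forall>z\<in>unit_disk. \<forall>\<rho>. 0 \<le> \<rho> \<longrightarrow> \<rho> \<le> 1 \<longrightarrow>
      cmod (f z - f (of_real \<rho> * z)) \<le> C * (1 - \<rho> * cmod z) powr \<delta>)"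
proof -
  define q where "q = 1 - 1 / (2 * c)"
  have q: "0 < q" "q < 1" using c by (auto simp: q_def field_simps)
  define d0 where "d0 = bdry_dist \<Omega> (f 0)"
  have d0: "0 \<le> d0" by (simp add: d0_def bdry_dist_def infdist_nonneg)
  \<comment> \<open>The minimum only serves to make \<open>\<delta>\<close> smaller than \<open>1\<close>.\<close>
  define \<delta> where "\<delta> = min (1/2) (ln q / ln l)"
  have lnl: "ln l < 0" using l by simp
  have \<delta>: "0 < \<delta>" "\<delta> < 1" using q lnl by (auto simp: \<delta>_def divide_neg_neg)
  have ql: "q \<le> l powr \<delta>"
  proof -
    have "\<delta> * ln l \<ge> ln q / ln l * ln l" using lnl by (intro mult_right_mono_neg) (auto simp: \<delta>_def)
    then have "ln q \<le> \<delta> * ln l" using lnl by simp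
    then have "exp (ln q) \<le> exp (\<delta> * ln l)" by simp
    then show ?thesis using q l by (simp add: powr_def)
  qed
  define C where "C = c * d0 * l powr (- \<delta>) + 1"
  have C: "0 < C" using c d0 by (simp add: C_def add_nonneg_pos)
  have main: "cmod (f z - f (of_real \<rho> * z)) \<le> C * (1 - \<rho> * cmod z) powr \<delta>"
    if z: "z \<in> unit_disk" and \<rho>: "0 \<le> \<rho>" "\<rho> \<le> 1" for z \<rho>
  proof (cases "z = 0")
    case True then show ?thesis using C by simp
  next
    case False
    define r where "r = cmod z"
    define e where "e = z / of_real r"
    have r: "0 < r" "r < 1" using z False by (auto simp: r_def)
    have e: "cmod e = 1" using r by (simp add: e_def norm_divide r_def)
    define p where "p s = f (of_real s * z)" for s
    \<comment> \<open>The curve \<open>p\<close> ends at \<open>z\<close>: its parameter \<open>t\<close> belongs to the point at distance \<open>t r\<close> from the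
      origin.\<close>
    have pe: "f (of_real x * e) = p (x / r)" for x
      using r by (simp add: p_def e_def)
    define \<Lambda> where "\<Lambda> t = enn2real (curve_length p t 1)" for t
    have fin: "curve_length p t 1 = ennreal (\<Lambda> t)" if "0 \<le> t" "t \<le> 1" for t
    proof -
      have "curve_length p t 1 < \<infinity>"
        using le_less_trans[OF John[OF z that]] by (simp add: p_def[abs_def])
      then show ?thesis by (simp add: \<Lambda>_def)
    qed
    have \<Lambda>0: "0 \<le> \<Lambda> t" for t by (simp add: \<Lambda>_def)
    have prepend: "dist (p a) (p b) + \<Lambda> b \<le> \<Lambda> a" if "0 \<le> a" "a \<le> b" "b \<le> 1" for a b
      using curve_length_prepend[of a b 1 p] that fin[of a] fin[of b] \<Lambda>0
      by (simp add: ennreal_plus[symmetric] ennreal_le_iff del: ennreal_plus)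
    have anti: "\<Lambda> b \<le> \<Lambda> a" if "0 \<le> a" "a \<le> b" "b \<le> 1" for a b
      using prepend[OF that] zero_le_dist[of "p a" "p b"] by linarith
    have Jp: "\<Lambda> t \<le> c * bdry_dist \<Omega> (p t)" if "0 \<le> t" "t \<le> 1" for t
      using John[OF z that] fin[OF that] c
      by (simp add: p_def[abs_def] ennreal_le_iff bdry_dist_def infdist_nonneg)
    have decay: "\<Lambda> ((1 - l ^ j) / r) \<le> q ^ j * (c * d0)" if "1 - l ^ j \<le> r" for j
      using that
    proof (induction j)
      case 0
      then show ?case using Jp[of 0] by (simp add: d0_def p_def)
    next
      case (Suc j)
      define s where "s = l ^ j"
      have s: "0 < s" "s \<le> 1" using l by (auto simp: s_def power_le_one)
      have lss: "l * s \<le> s" using l s by (simp add: mult_left_le_one_le)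
      have rs: "1 - l * s \<le> r" using Suc.prems by (simp add: s_def)
      obtain \<sigma> where \<sigma>: "l * s \<le> \<sigma>" "\<sigma> \<le> s"
        "bdry_dist \<Omega> (p ((1 - s) / r)) / 2 \<le> dist (p ((1 - s) / r)) (p ((1 - \<sigma>) / r))"
        using step[OF e s] unfolding pe by (auto simp: dist_norm norm_minus_commute)
      let ?a = "(1 - s) / r" and ?b = "(1 - \<sigma>) / r" and ?b' = "(1 - l * s) / r"
      have ord: "0 \<le> ?a" "?a \<le> ?b" "?b \<le> ?b'" "?b' \<le> 1"
        using r s \<sigma> rs by (auto intro!: divide_right_mono)
      have "\<Lambda> ?a \<le> q ^ j * (c * d0)"
        using Suc.IH rs lss by (simp add: s_def)
      moreover have "\<Lambda> ?a / (2 * c) \<le> bdry_dist \<Omega> (p ?a) / 2"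
        using Jp[of ?a] ord c by (simp add: field_simps)
      moreover have "dist (p ?a) (p ?b) + \<Lambda> ?b \<le> \<Lambda> ?a" using ord by (intro prepend) auto
      moreover have "\<Lambda> ?b' \<le> \<Lambda> ?b" using ord by (intro anti) auto
      ultimately have "\<Lambda> ?b' \<le> \<Lambda> ?a - \<Lambda> ?a / (2 * c)" using \<sigma>(3) by linarith
      also have "\<dots> = q * \<Lambda> ?a" by (simp add: q_def algebra_simps)
      also have "\<dots> \<le> q * (q ^ j * (c * d0))"
        using \<open>\<Lambda> ?a \<le> q ^ j * (c * d0)\<close> q by (intro mult_left_mono) auto
      finally show ?case by (simp add: s_def mult.assoc)
    qed
    define y where "y = 1 - \<rho> * r"
    have "\<rho> * r \<le> 1 * r" using \<rho> r by (intro mult_right_mono) auto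
    then have y: "0 < y" "y \<le> 1" "1 - y \<le> r"
      unfolding y_def using r mult_nonneg_nonneg[of \<rho> r] \<rho> by linarith+
    obtain j where j: "l ^ Suc j < y" "y \<le> l ^ j" using ex_power_bracket[OF l y(1,2)] by blast
    have "cmod (f z - f (of_real \<rho> * z)) = dist (p \<rho>) (p 1)"
      by (simp add: p_def dist_norm norm_minus_commute)
    also have "\<dots> \<le> \<Lambda> \<rho>" using prepend[of \<rho> 1] \<Lambda>0[of 1] \<rho> by linarith
    also have "\<dots> \<le> \<Lambda> ((1 - l ^ j) / r)"
    proof (rule anti)
      show "0 \<le> (1 - l ^ j) / r" using l r by (simp add: power_le_one)
      show "(1 - l ^ j) / r \<le> \<rho>" using j r by (simp add: y_def field_simps)
    qed (use \<rho> in auto)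
    also have "\<dots> \<le> q ^ j * (c * d0)" by (rule decay) (use j y in linarith)
    also have "\<dots> \<le> (l powr \<delta>) ^ j * (c * d0)"
      using ql q c d0 by (intro mult_right_mono power_mono) auto
    also have "(l powr \<delta>) ^ j = (l ^ j) powr \<delta>"
      using l by (simp add: powr_powr powr_realpow[symmetric] mult.commute)
    also have "l ^ j = l ^ Suc j / l" using l by simp
    also have "(l ^ Suc j / l) powr \<delta> \<le> (y / l) powr \<delta>"
      using j l \<delta> by (intro powr_mono2 divide_right_mono) auto
    then have "(l ^ Suc j / l) powr \<delta> * (c * d0) \<le> (y / l) powr \<delta> * (c * d0)"
      using c d0 by (intro mult_right_mono) auto
    also have "(y / l) powr \<delta> * (c * d0) = c * d0 * l powr (- \<delta>) * y powr \<delta>"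
      using y l by (simp add: powr_divide powr_minus_divide)
    also have "\<dots> \<le> C * y powr \<delta>" by (intro mult_right_mono) (auto simp: C_def)
    finally show ?thesis by (simp add: y_def r_def)
  qed
  show ?thesis
    by (rule exI[of _ C], intro conjI C exI[of _ \<delta>] \<delta> ballI allI impI main)
qed

section \<open>From radii to the whole disk\<close>

text \<open>
  Cauchy's estimate on the concentric disk of half the radius is applied to \<open>exp (F / M)\<close>, whose
  modulus lies between \<open>exp (- 1)\<close> and \<open>exp 1\<close>.
\<close>

lemma deriv_bound_of_Re_bound:
  assumes F: "F holomorphic_on ball z r" and r: "r > 0" and M: "M > 0"
    and bd: "\<And>w. w \<in> ball z r \<Longrightarrow> \<bar>Re (F w)\<bar> \<le> M"
  shows "cmod (deriv F z) \<le> 2 * exp 2 * M / r"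
proof -
  define G where "G = (\<lambda>w. exp (F w / of_real M))"
  have hG: "G holomorphic_on ball z r"
    unfolding G_def using F M by (intro holomorphic_intros) auto
  have nG: "cmod (G w) = exp (Re (F w) / M)" for w
    by (simp add: G_def)
  have "cmod ((deriv ^^ 1) G z) \<le> fact 1 * exp 1 / (r/2)^1"
  proof (rule Cauchy_inequality)
    show "G holomorphic_on ball z (r/2)"
      using hG r by (auto intro: holomorphic_on_subset)
    show "continuous_on (cball z (r/2)) G"
      using hG r by (intro holomorphic_on_imp_continuous_on) (auto intro: holomorphic_on_subset)
    fix w assume "cmod (z - w) = r / 2"
    then have "w \<in> ball z r" using r by (simp add: dist_norm)
    from bd[OF this] have "Re (F w) / M \<le> 1" using M by (simp add: field_simps)
    then show "cmod (G w) \<le> exp 1" by (simp add: nG)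
  qed (use r in auto)
  then have 1: "cmod (deriv G z) \<le> 2 * exp 1 / r" by (simp add: field_simps)
  have "(F has_field_derivative deriv F z) (at z)"
    using F r by (intro holomorphic_derivI) auto
  then have "(G has_field_derivative G z * (deriv F z / of_real M)) (at z)"
    unfolding G_def using M by (auto intro!: derivative_eq_intros)
  then have 2: "deriv G z = G z * (deriv F z / of_real M)" by (rule DERIV_imp_deriv)
  have "z \<in> ball z r" using r by simp
  from bd[OF this] have "-1 \<le> Re (F z) / M" using M by (simp add: field_simps)
  then have "exp (-1) \<le> cmod (G z)" by (simp add: nG)
  then have "exp (-1) * (cmod (deriv F z) / M) \<le> cmod (G z) * (cmod (deriv F z) / M)"
    using M by (intro mult_right_mono) auto
  also have "\<dots> \<le> 2 * exp 1 / r"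
    using 1 M by (simp add: 2 norm_mult norm_divide)
  finally have "exp 1 * (exp (-1) * (cmod (deriv F z) / M)) \<le> exp 1 * (2 * exp 1 / r)"
    by (intro mult_left_mono) auto
  moreover have "exp 1 * (exp (-1) * x) = x" for x :: real
    by (simp flip: mult.assoc exp_add)
  moreover have "exp 1 * (2 * exp 1 / r) = 2 * exp 2 / r"
    using exp_add[of 1 "1::real"] by simp
  ultimately have "cmod (deriv F z) / M \<le> 2 * exp 2 / r"
    by metis
  then show ?thesis using M by (simp add: field_simps)
qed

text \<open>
  The real and imaginary parts of \<open>h + cnj g\<close> are the real parts of the holomorphic functions
  \<open>h + g\<close> and \<open>- \<i> (h - g)\<close>, so the sum and the difference of the two derivatives are bounded.
\<close>

lemma harmonic_gradient_bound:
  assumes h: "h holomorphic_on ball z r" and g: "g holomorphic_on ball z r"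
    and r: "r > 0" and M: "M > 0"
    and bd: "\<And>w. w \<in> ball z r \<Longrightarrow> cmod (h w + cnj (g w)) \<le> M"
  shows "cmod (deriv h z) + cmod (deriv g z) \<le> 4 * exp 2 * M / r"
proof -
  define X where "X = 2 * exp 2 * M / r"
  have hz: "h field_differentiable at z" "g field_differentiable at z"
    using h g r by (auto intro: holomorphic_on_imp_differentiable_at)
  have "cmod (deriv (\<lambda>w. h w + g w) z) \<le> X"
    unfolding X_def
  proof (rule deriv_bound_of_Re_bound[OF _ r M])
    fix w assume "w \<in> ball z r"
    then show "\<bar>Re (h w + g w)\<bar> \<le> M"
      using bd[of w] abs_Re_le_cmod[of "h w + cnj (g w)"] by auto
  qed (use h g in \<open>auto intro!: holomorphic_intros\<close>)
  then have 1: "cmod (deriv h z + deriv g z) \<le> X"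
    using hz by (simp add: deriv_add)
  have "cmod (deriv (\<lambda>w. \<i> * h w - \<i> * g w) z) \<le> X"
    unfolding X_def
  proof (rule deriv_bound_of_Re_bound[OF _ r M])
    fix w assume "w \<in> ball z r"
    then show "\<bar>Re (\<i> * h w - \<i> * g w)\<bar> \<le> M"
      using bd[of w] abs_Im_le_cmod[of "h w + cnj (g w)"] by auto
  qed (use h g in \<open>auto intro!: holomorphic_intros\<close>)
  moreover have "deriv (\<lambda>w. \<i> * h w - \<i> * g w) z = \<i> * (deriv h z - deriv g z)"
    by (rule DERIV_imp_deriv)
       (use hz[THEN field_differentiable_derivI] in \<open>auto intro!: derivative_eq_intros simp: algebra_simps\<close>)
  ultimately have 2: "cmod (deriv h z - deriv g z) \<le> X"
    by (simp add: norm_mult)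
  have "cmod (2 * deriv h z) \<le> 2 * X"
    using order_trans[OF norm_triangle_ineq add_mono[OF 1 2]] by (simp add: mult.commute)
  moreover have "cmod (2 * deriv g z) \<le> 2 * X"
    using order_trans[OF norm_triangle_ineq4 add_mono[OF 1 2]] by (simp add: mult.commute)
  moreover have "cmod (2 * deriv h z) = 2 * cmod (deriv h z)" "cmod (2 * deriv g z) = 2 * cmod (deriv g z)"
    by (simp_all add: norm_mult)
  ultimately have "cmod (deriv h z) + cmod (deriv g z) \<le> 2 * X" by linarith
  then show ?thesis by (simp add: X_def)
qed

text \<open>
  Let \<open>t = 1 - \<bar>z\<bar>\<close>.  The difference between \<open>f\<close> and its dilate by \<open>1 - t\<close> is harmonic and
  at most \<open>3 C t powr \<delta>\<close> on \<open>ball z (t / 2)\<close>, so the gradient at \<open>z\<close> exceeds the gradient at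
  \<open>(1 - t) z\<close> by at most a multiple of \<open>t powr (\<delta> - 1)\<close>.  The point \<open>(1 - t) z\<close> is farther from the
  circle by a factor of at least \<open>3 / 2\<close>, so finitely many such steps lead to \<open>cball 0 (1 / 2)\<close>, and the
  errors form a geometric series because \<open>\<delta> < 1\<close>.
\<close>

lemma gradient_growth_of_radial_Hoelder:
  assumes h: "h holomorphic_on unit_disk" and g: "g holomorphic_on unit_disk"
    and C: "C > 0" and \<delta>: "0 < \<delta>" "\<delta> < 1"
    and rad: "\<And>z \<rho>. z \<in> unit_disk \<Longrightarrow> 0 \<le> \<rho> \<Longrightarrow> \<rho> \<le> 1 \<Longrightarrow>
      cmod ((h z + cnj (g z)) - (h (of_real \<rho> * z) + cnj (g (of_real \<rho> * z))))
        \<le> C * (1 - \<rho> * cmod z) powr \<delta>"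
  shows "\<exists>B>0. \<forall>z\<in>unit_disk. cmod (deriv h z) + cmod (deriv g z) \<le> B * (1 - cmod z) powr (\<delta> - 1)"
proof -
  let ?D = "\<lambda>z. cmod (deriv h z) + cmod (deriv g z)"
  have "continuous_on (cball 0 (1/2)) ?D"
    by (intro continuous_intros holomorphic_on_imp_continuous_on
         holomorphic_on_subset[OF holomorphic_deriv[OF h]] holomorphic_on_subset[OF holomorphic_deriv[OF g]]) auto
  then have "bounded (?D ` cball 0 (1/2))"
    by (intro compact_imp_bounded compact_continuous_image) auto
  then obtain B0 where B0: "B0 > 0" "\<And>z. z \<in> cball 0 (1/2) \<Longrightarrow> ?D z \<le> B0"
    unfolding bounded_pos by force
  define A where "A = 24 * exp 2 * C"
  define q :: real where "q = (3/2) powr (\<delta> - 1)"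
  have q: "0 < q" "q < 1"
    using \<delta> by (auto simp: q_def powr_less_one)
  have A: "A > 0" using C by (simp add: A_def)
  \<comment> \<open>\<open>B\<close> is chosen such that \<open>B q + A \<le> B\<close>, which closes the induction below.\<close>
  define B where "B = B0 + A / (1 - q)"
  have B: "B > 0" "B0 \<le> B" using B0 A q by (auto simp: B_def add_pos_pos)
  have "B0 * q \<le> B0" using B0 q by (simp add: mult_left_le)
  moreover have "A / (1 - q) * q + A = A / (1 - q)" using q by (simp add: field_simps)
  ultimately have BqA: "B * q + A \<le> B" by (simp add: B_def algebra_simps)
  have one_le: "1 \<le> t powr (\<delta> - 1)" if "0 < t" "t \<le> 1" for t :: real
    using powr_mono'[of "\<delta> - 1" 0 t] that \<delta> by simp
  \<comment> \<open>\<open>n\<close> bounds the number of dilations that are needed to come within distance \<open>1 / 2\<close> of the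
    origin.\<close>
  have key: "?D z \<le> B * (1 - cmod z) powr (\<delta> - 1)"
    if "z \<in> unit_disk" "(3/2) ^ n * (1 - cmod z) \<ge> 1/2" for z n
    using that
  proof (induction n arbitrary: z)
    case 0
    then have "?D z \<le> B0" by (intro B0) auto
    also have "\<dots> \<le> B * 1" using B by simp
    also have "\<dots> \<le> B * (1 - cmod z) powr (\<delta> - 1)"
      using one_le[of "1 - cmod z"] 0 B by (intro mult_left_mono) auto
    finally show ?case .
  next
    case (Suc n)
    define t where "t = 1 - cmod z"
    have t0: "t > 0" using Suc.prems by (simp add: t_def)
    show ?case
    proof (cases "t \<ge> 1/2")
      case True
      then have "?D z \<le> B0" by (intro B0) (auto simp: t_def)
      also have "\<dots> \<le> B * 1" using B by simp
      also have "\<dots> \<le> B * (1 - cmod z) powr (\<delta> - 1)"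
        using one_le[of "1 - cmod z"] Suc.prems B by (intro mult_left_mono) auto
      finally show ?thesis .
    next
      case False
      then have t: "t < 1/2" by simp
      define l where "l = 1 - t"
      have l: "0 < l" "l < 1" using t t0 by (auto simp: l_def)
      define H where "H = (\<lambda>w. h w - h (of_real l * w))"
      define G where "G = (\<lambda>w. g w - g (of_real l * w))"
      have sub: "ball z (t/2) \<subseteq> unit_disk"
      proof
        fix w assume "w \<in> ball z (t/2)"
        then show "w \<in> unit_disk"
          using norm_triangle_sub[of w z] t0 by (auto simp: dist_norm norm_minus_commute t_def)
      qed
      have lw: "of_real l * w \<in> unit_disk" if "w \<in> unit_disk" for w
        using that l by (auto simp: norm_mult intro!: le_less_trans[OF mult_left_le_one_le])
      have der: "(H has_field_derivative (deriv h w - of_real l * deriv h (of_real l * w))) (at w)"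
                "(G has_field_derivative (deriv g w - of_real l * deriv g (of_real l * w))) (at w)"
        if w: "w \<in> unit_disk" for w
      proof -
        have *: "((\<lambda>w. k w - k (of_real l * w)) has_field_derivative
               (deriv k w - of_real l * deriv k (of_real l * w))) (at w)"
          if k: "k holomorphic_on unit_disk" for k
        proof -
          have 1: "(k has_field_derivative deriv k w) (at w)"
            using k w by (intro holomorphic_derivI[OF k]) auto
          have 2: "(k has_field_derivative deriv k (of_real l * w)) (at (of_real l * w))"
            using k lw[OF w] by (intro holomorphic_derivI[OF k]) auto
          have 3: "((\<lambda>w. of_real l * w) has_field_derivative of_real l) (at w)"
            by (auto intro!: derivative_eq_intros)
          have "((\<lambda>w. k (of_real l * w)) has_field_derivative deriv k (of_real l * w) * of_real l) (at w)"
            by (rule DERIV_chain2[OF 2 3])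
          from DERIV_diff[OF 1 this] show ?thesis by (simp add: mult.commute)
        qed
        show "(H has_field_derivative (deriv h w - of_real l * deriv h (of_real l * w))) (at w)"
                "(G has_field_derivative (deriv g w - of_real l * deriv g (of_real l * w))) (at w)"
          unfolding H_def G_def using *[OF h] *[OF g] by auto
      qed
      have "cmod (deriv H z) + cmod (deriv G z) \<le> 4 * exp 2 * (3 * C * t powr \<delta>) / (t/2)"
      proof (rule harmonic_gradient_bound)
        show "H holomorphic_on ball z (t/2)" "G holomorphic_on ball z (t/2)"
          unfolding holomorphic_on_open[OF open_ball] using der sub by blast+
        fix w assume w: "w \<in> ball z (t/2)"
        have wn: "cmod w \<ge> 1 - 3*t/2"
        proof -
          have "cmod (z - w) < t/2" using w by (simp add: dist_norm)
          moreover have "cmod z = 1 - t" by (simp add: t_def)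
          ultimately show ?thesis using norm_triangle_sub[of z w] by linarith
        qed
        have "1 - l * cmod w \<le> 5/2 * t"
        proof -
          have "l * cmod w \<ge> l * (1 - 3*t/2)" using wn l by (intro mult_left_mono) auto
          also have "l * (1 - 3*t/2) = 1 - 5/2*t + 3/2 * t * t" by (simp add: l_def field_simps)
          finally show ?thesis using mult_nonneg_nonneg[of t t] t0 by linarith
        qed
        moreover have "0 \<le> 1 - l * cmod w"
          using w sub l lw[of w] by (auto simp: norm_mult)
        ultimately have "(1 - l * cmod w) powr \<delta> \<le> (5/2 * t) powr \<delta>"
          using \<delta> by (intro powr_mono2) auto
        also have "\<dots> = (5/2) powr \<delta> * t powr \<delta>" using t0 powr_mult[of "5/2" t \<delta>] by simp
        also have "\<dots> \<le> 3 * t powr \<delta>"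
          using \<delta> powr_mono[of \<delta> 1 "5/2::real"] by (intro mult_right_mono) auto
        finally have "(1 - l * cmod w) powr \<delta> \<le> 3 * t powr \<delta>" .
        then have "C * (1 - l * cmod w) powr \<delta> \<le> 3 * C * t powr \<delta>" using C by simp
        moreover have "cmod (H w + cnj (G w)) \<le> C * (1 - l * cmod w) powr \<delta>"
          using rad[of w l] w sub l by (auto simp: H_def G_def algebra_simps)
        ultimately show "cmod (H w + cnj (G w)) \<le> 3 * C * t powr \<delta>" by linarith
      qed (use t0 C in auto)
      also have "4 * exp 2 * (3 * C * t powr \<delta>) / (t/2) = A * t powr (\<delta> - 1)"
        using t0 by (simp add: A_def powr_diff)
      finally have 1: "cmod (deriv H z) + cmod (deriv G z) \<le> A * t powr (\<delta> - 1)" .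
      have dH: "deriv H z = deriv h z - of_real l * deriv h (of_real l * z)"
               "deriv G z = deriv g z - of_real l * deriv g (of_real l * z)"
        using der[of z] Suc.prems by (auto intro: DERIV_imp_deriv)
      have ll: "l * x \<le> x" if "x \<ge> 0" for x using that l by (simp add: mult_left_le_one_le)
      have "cmod (deriv h z) \<le> cmod (deriv H z) + cmod (deriv h (of_real l * z))"
        using norm_triangle_sub[of "deriv h z" "of_real l * deriv h (of_real l * z)"] l
          ll[of "cmod (deriv h (of_real l * z))"]
        by (simp add: dH norm_mult)
      moreover have "cmod (deriv g z) \<le> cmod (deriv G z) + cmod (deriv g (of_real l * z))"
        using norm_triangle_sub[of "deriv g z" "of_real l * deriv g (of_real l * z)"] l
          ll[of "cmod (deriv g (of_real l * z))"]
        by (simp add: dH norm_mult)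
      ultimately have 2: "?D z \<le> ?D (of_real l * z) + A * t powr (\<delta> - 1)"
        using 1 by linarith
      have t': "1 - cmod (of_real l * z) \<ge> 3/2 * t"
      proof -
        have "cmod z = 1 - t" by (simp add: t_def)
        moreover have "cmod (of_real l * z) = l * cmod z" using l by (simp add: norm_mult)
        ultimately have "1 - cmod (of_real l * z) = 1 - (1 - t) * (1 - t)"
          by (simp only: l_def)
        then have "1 - cmod (of_real l * z) = 2 * t - t * t"
          by (simp only: algebra_simps)
        moreover have "t * t \<le> 1/2 * t" using t t0 by (intro mult_right_mono) auto
        ultimately show ?thesis by linarith
      qed
      have "?D (of_real l * z) \<le> B * (1 - cmod (of_real l * z)) powr (\<delta> - 1)"
      proof (rule Suc.IH)
        show "of_real l * z \<in> unit_disk" using lw Suc.prems by blast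
        have "(3/2) ^ n * (1 - cmod (of_real l * z)) \<ge> (3/2) ^ n * (3/2 * t)"
          using t' by (intro mult_left_mono) auto
        moreover have "(3/2) ^ n * (3/2 * t) = (3/2) ^ Suc n * (1 - cmod z)" by (simp add: t_def)
        ultimately show "(3/2) ^ n * (1 - cmod (of_real l * z)) \<ge> 1/2"
          using Suc.prems(2) by linarith
      qed
      also have "\<dots> \<le> B * (3/2 * t) powr (\<delta> - 1)"
        using B t0 \<delta> t' by (intro mult_left_mono powr_mono2') auto
      also have "\<dots> = B * q * t powr (\<delta> - 1)"
        using t0 powr_mult[of "3/2" t "\<delta> - 1"] by (simp add: q_def)
      finally have "?D z \<le> (B * q + A) * t powr (\<delta> - 1)"
        using 2 by (simp add: algebra_simps)
      also have "\<dots> \<le> B * t powr (\<delta> - 1)"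
        using BqA by (intro mult_right_mono) auto
      finally show ?thesis by (simp add: t_def)
    qed
  qed
  have "?D z \<le> B * (1 - cmod z) powr (\<delta> - 1)" if z: "z \<in> unit_disk" for z
  proof -
    have "\<exists>n. 1 / (1 - cmod z) < (3/2) ^ n" by (rule real_arch_pow) simp
    then obtain n where "1 / (1 - cmod z) < (3/2) ^ n" by blast
    then have "1 < (3/2) ^ n * (1 - cmod z)" using z by (simp add: pos_divide_less_eq)
    then have "(3/2) ^ n * (1 - cmod z) \<ge> 1/2" by linarith
    then show ?thesis using key z by blast
  qed
  then show ?thesis using B by blast
qed

text \<open>
  Let \<open>s = \<bar>x - y\<bar>\<close>.  If \<open>x\<close> and \<open>y\<close> have distance at least \<open>s\<close> to the circle, the gradient bound
  is integrated along the segment between them.  Otherwise both points have distance at most \<open>2 s\<close>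
  to the circle; they are first moved radially to \<open>(1 - s) x\<close> and \<open>(1 - s) y\<close>, which costs a
  multiple of \<open>s powr \<delta>\<close>, and then the first case applies.
\<close>

lemma Hoelder_of_radial_Hoelder:
  assumes h: "h holomorphic_on unit_disk" and g: "g holomorphic_on unit_disk"
    and f: "\<And>z. z \<in> unit_disk \<Longrightarrow> f z = h z + cnj (g z)"
    and C: "C > 0" and \<delta>: "0 < \<delta>" "\<delta> < 1"
    and rad: "\<And>z \<rho>. z \<in> unit_disk \<Longrightarrow> 0 \<le> \<rho> \<Longrightarrow> \<rho> \<le> 1 \<Longrightarrow>
      cmod (f z - f (of_real \<rho> * z)) \<le> C * (1 - \<rho> * cmod z) powr \<delta>"
  shows "\<exists>C>0. \<forall>x\<in>unit_disk. \<forall>y\<in>unit_disk. cmod (f x - f y) \<le> C * cmod (x - y) powr \<delta>"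
proof -
  have lz: "of_real \<rho> * z \<in> unit_disk" if "z \<in> unit_disk" "0 \<le> \<rho>" "\<rho> \<le> 1" for z \<rho>
    using that by (auto simp: norm_mult intro!: le_less_trans[OF mult_left_le_one_le])
  have "\<exists>B>0. \<forall>z\<in>unit_disk. cmod (deriv h z) + cmod (deriv g z) \<le> B * (1 - cmod z) powr (\<delta> - 1)"
  proof (rule gradient_growth_of_radial_Hoelder[OF h g C \<delta>])
    fix z and r :: real assume "z \<in> unit_disk" "0 \<le> r" "r \<le> 1"
    then show "cmod ((h z + cnj (g z)) - (h (of_real r * z) + cnj (g (of_real r * z))))
        \<le> C * (1 - r * cmod z) powr \<delta>"
      using rad[of z r] f[of z] f[OF lz[of z r]] by simp
  qed
  then obtain B where B: "B > 0"
    "\<And>z. z \<in> unit_disk \<Longrightarrow> cmod (deriv h z) + cmod (deriv g z) \<le> B * (1 - cmod z) powr (\<delta> - 1)"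
    by blast
  have seg: "cmod (f x - f y) \<le> 2 * B * s powr \<delta>"
    if s: "0 < s" "s < 1" and x: "cmod x \<le> 1 - s" and y: "cmod y \<le> 1 - s" and xy: "cmod (x - y) \<le> s" for x y s
  proof -
    have *: "cmod (k x - k y) \<le> B * s powr (\<delta> - 1) * cmod (x - y)"
      if k: "k holomorphic_on unit_disk"
        "\<And>z. z \<in> unit_disk \<Longrightarrow> cmod (deriv k z) \<le> B * (1 - cmod z) powr (\<delta> - 1)" for k
    proof (rule field_differentiable_bound[where S="cball 0 (1 - s)" and f'="deriv k"])
      fix z assume "z \<in> cball (0::complex) (1 - s)"
      then have z: "cmod z \<le> 1 - s" by simp
      then have zu: "z \<in> unit_disk" using s by simp
      show "(k has_field_derivative deriv k z) (at z within cball 0 (1 - s))"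
        by (rule has_field_derivative_at_within[OF holomorphic_derivI[OF k(1) open_ball zu]])
      have "cmod (deriv k z) \<le> B * (1 - cmod z) powr (\<delta> - 1)" using k zu by blast
      also have "\<dots> \<le> B * s powr (\<delta> - 1)"
        using B s z \<delta> by (intro mult_left_mono powr_mono2') auto
      finally show "cmod (deriv k z) \<le> B * s powr (\<delta> - 1)" .
    qed (use x y in auto)
    have "B * s powr (\<delta> - 1) * cmod (x - y) \<le> B * s powr (\<delta> - 1) * s"
      using B xy by (intro mult_left_mono) auto
    also have "\<dots> = B * s powr \<delta>" using s by (simp add: powr_diff)
    finally have **: "B * s powr (\<delta> - 1) * cmod (x - y) \<le> B * s powr \<delta>" .
    have "cmod (h x - h y) \<le> B * s powr \<delta>"
      by (rule order_trans[OF *[OF h order_trans[OF _ B(2)]] **]) auto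
    moreover have "cmod (g x - g y) \<le> B * s powr \<delta>"
      by (rule order_trans[OF *[OF g order_trans[OF _ B(2)]] **]) auto
    moreover have "f x - f y = (h x - h y) + cnj (g x - g y)"
      using f[of x] f[of y] x y s by (simp add: algebra_simps)
    ultimately show ?thesis
      using norm_triangle_ineq[of "h x - h y" "cnj (g x - g y)"] by (simp only: complex_mod_cnj)
  qed
  have big: "cmod (f x - f y) \<le> 2 * C * s powr \<delta>"
    if "x \<in> unit_disk" "y \<in> unit_disk" "s \<ge> 1" for x y s
  proof -
    have "cmod (f x - f 0) \<le> C" "cmod (f y - f 0) \<le> C"
      using rad[of x 0] rad[of y 0] that by auto
    then have "cmod (f x - f y) \<le> 2 * C" using norm_triangle_ineq4[of "f x - f 0" "f y - f 0"] by simp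
    also have "\<dots> \<le> 2 * C * s powr \<delta>" using C \<delta> that ge_one_powr_ge_zero[of s \<delta>] by simp
    finally show ?thesis .
  qed
  have sm: "cmod (f x - f y) \<le> (8 * C + 2 * B) * s powr \<delta>"
    if x: "x \<in> unit_disk" and y: "y \<in> unit_disk" and s: "0 < s" "s < 1" and xy: "s = cmod (x - y)" for x y s
  proof (cases "cmod x \<le> 1 - s \<and> cmod y \<le> 1 - s")
    case True
    then have "cmod (f x - f y) \<le> 2 * B * s powr \<delta>" using seg s xy by simp
    also have "\<dots> \<le> (8 * C + 2 * B) * s powr \<delta>" using C by (intro mult_right_mono) auto
    finally show ?thesis .
  next
    case False
    have nx: "1 - cmod x \<le> 2 * s" and ny: "1 - cmod y \<le> 2 * s"
      using False xy norm_triangle_sub[of x y] norm_triangle_sub[of y x]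
      by (auto simp: norm_minus_commute)
    let ?l = "1 - s"
    have shrink: "cmod (f z - f (of_real ?l * z)) \<le> 3 * C * s powr \<delta>"
      if z: "z \<in> unit_disk" "1 - cmod z \<le> 2 * s" for z
    proof -
      have "s * cmod z \<le> s" using s z by (simp add: mult_left_le)
      moreover have "1 - ?l * cmod z = 1 - cmod z + s * cmod z" by (simp add: algebra_simps)
      ultimately have "1 - ?l * cmod z \<le> 3 * s" using z by linarith
      moreover have "0 \<le> 1 - ?l * cmod z" using lz[of z ?l] z s by (simp add: norm_mult del: of_real_diff)
      ultimately have "(1 - ?l * cmod z) powr \<delta> \<le> (3 * s) powr \<delta>"
        using \<delta> by (intro powr_mono2) auto
      also have "\<dots> = 3 powr \<delta> * s powr \<delta>" using s by (simp add: powr_mult)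
      also have "\<dots> \<le> 3 * s powr \<delta>"
        using \<delta> powr_mono[of \<delta> 1 "3::real"] by (intro mult_right_mono) auto
      finally have "C * (1 - ?l * cmod z) powr \<delta> \<le> C * (3 * s powr \<delta>)"
        using C by (intro mult_left_mono) auto
      then show ?thesis using rad[of z ?l] z s by linarith
    qed
    have "cmod (f (of_real ?l * x) - f (of_real ?l * y)) \<le> 2 * B * s powr \<delta>"
    proof (rule seg[OF s])
      show "cmod (of_real ?l * x) \<le> 1 - s" "cmod (of_real ?l * y) \<le> 1 - s"
        using x y s by (simp_all add: norm_mult mult_left_le del: of_real_diff)
      have "of_real ?l * x - of_real ?l * y = of_real ?l * (x - y)" by (simp add: algebra_simps)
      then show "cmod (of_real ?l * x - of_real ?l * y) \<le> s"
        using s xy by (simp add: norm_mult mult_left_le_one_le del: of_real_diff)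
    qed
    moreover have "f x - f y = (f x - f (of_real ?l * x)) + (f (of_real ?l * x) - f (of_real ?l * y))
        - (f y - f (of_real ?l * y))" by simp
    ultimately have "cmod (f x - f y) \<le> 3 * C * s powr \<delta> + 2 * B * s powr \<delta> + 3 * C * s powr \<delta>"
      using shrink[OF x nx] shrink[OF y ny]
      by (smt (verit) norm_triangle_ineq norm_triangle_ineq4)
    also have "\<dots> \<le> (8 * C + 2 * B) * s powr \<delta>" using C by (simp add: algebra_simps)
    finally show ?thesis .
  qed
  have "cmod (f x - f y) \<le> (8 * C + 2 * B) * cmod (x - y) powr \<delta>"
    if x: "x \<in> unit_disk" and y: "y \<in> unit_disk" for x y
  proof -
    consider "cmod (x - y) = 0" | "0 < cmod (x - y)" "cmod (x - y) < 1" | "cmod (x - y) \<ge> 1" 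
      by fastforce
    then show ?thesis
    proof cases
      case 1 then show ?thesis by simp
    next
      case 2 then show ?thesis using sm x y by blast
    next
      case 3
      then have "cmod (f x - f y) \<le> 2 * C * cmod (x - y) powr \<delta>" using big x y by blast
      also have "\<dots> \<le> (8 * C + 2 * B) * cmod (x - y) powr \<delta>" using C B by (intro mult_right_mono) auto
      finally show ?thesis .
    qed
  qed
  then show ?thesis using C B by (intro exI[of _ "8 * C + 2 * B"]) auto
qed

section \<open>Hoelder continuity on the disk\<close>

theorem corollary1p3:
  fixes K :: real and f :: "complex \<Rightarrow> complex" and \<Omega> :: "complex set"
  assumes "K \<ge> 1"
    and "f \<in> S_H0_qc K \<Omega>"
    and "radial_John_disk f \<Omega>"
  shows "\<exists>C>0. \<exists>\<delta>. 0 < \<delta> \<and> \<delta> < 1 \<and>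
    (\<forall>\<zeta>\<^sub>1\<in>unit_disk. \<forall>\<zeta>\<^sub>2\<in>unit_disk.
       cmod (f \<zeta>\<^sub>1 - f \<zeta>\<^sub>2) \<le> C * cmod (\<zeta>\<^sub>1 - \<zeta>\<^sub>2) powr \<delta>)"
proof -
  have qc: "quasiconformal_on K unit_disk f" and im: "f ` unit_disk = \<Omega>" and "f \<in> S_H"
    using assms(2) by (auto simp: S_H0_qc_def S_H0_def)
  then obtain h g where inj: "inj_on f unit_disk" and rep: "canonical_rep f h g"
    and J: "\<And>z. z \<in> unit_disk \<Longrightarrow> (cmod (deriv h z))\<^sup>2 - (cmod (deriv g z))\<^sup>2 > 0"
    unfolding S_H_def by blast
  have h: "h holomorphic_on unit_disk" and g: "g holomorphic_on unit_disk"
    and f: "\<And>z. z \<in> unit_disk \<Longrightarrow> f z = h z + cnj (g z)"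
    using rep by (auto simp: canonical_rep_def)
  have dil: "(cmod (deriv h z) + cmod (deriv g z))\<^sup>2 \<le> K * ((cmod (deriv h z))\<^sup>2 - (cmod (deriv g z))\<^sup>2)"
    if "z \<in> unit_disk" for z
    using qc_harmonic_dilatation[OF qc h g f that] J[OF that] by simp
  obtain c where c: "c \<ge> 1" and John: "\<And>z t. z \<in> unit_disk \<Longrightarrow> 0 \<le> t \<Longrightarrow> t \<le> 1 \<Longrightarrow>
        curve_length (\<lambda>s. f (of_real s * z)) t 1 \<le> ennreal (c * bdry_dist \<Omega> (f (of_real t * z)))"
    using assms(3) unfolding radial_John_disk_def radial_c_John_disk_def by force
  \<comment> \<open>This makes \<open>ln (1 / l)\<close> exceed the bound \<open>128 K\<close> of the length-area estimate.\<close>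
  define l where "l = exp (- (129 * K))"
  have l: "0 < l" "l < 1" using assms(1) by (auto simp: l_def)
  have step: "\<exists>\<sigma>. l * s \<le> \<sigma> \<and> \<sigma> \<le> s \<and>
        bdry_dist \<Omega> (f (of_real (1 - s) * e)) / 2 \<le> cmod (f (of_real (1 - \<sigma>) * e) - f (of_real (1 - s) * e))"
    if e: "cmod e = 1" and s: "0 < s" "s \<le> 1" for e s
  proof (rule ccontr)
    let ?w = "f (of_real (1 - s) * e)"
    assume "\<not> ?thesis"
    then have near: "\<And>\<sigma>. l * s \<le> \<sigma> \<Longrightarrow> \<sigma> \<le> s \<Longrightarrow> cmod (f (of_real (1 - \<sigma>) * e) - ?w) < bdry_dist \<Omega> ?w / 2"
      by force
    have "l * s \<le> s" using l s by (simp add: mult_left_le_one_le)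
    from near[OF this order_refl] have d: "0 < bdry_dist \<Omega> ?w" by simp
    have "cmod (of_real (1 - s) * e) < 1"
      using s e by (simp add: norm_mult del: of_real_diff)
    then have "?w \<in> \<Omega>" using im by auto
    then have "ball ?w (bdry_dist \<Omega> ?w) \<subseteq> f ` unit_disk" using ball_bdry_dist_subset im by blast
    from log_length_le_of_small_radial_oscillation[OF h g f inj dil assms(1) e s l this d near]
    have "ln (1 / l) \<le> 128 * K" by simp
    moreover have "ln (1 / l) = 129 * K" by (simp add: l_def ln_div)
    ultimately show False using assms(1) by simp
  qed
  obtain C \<delta> where C: "0 < C" and \<delta>: "0 < \<delta>" "\<delta> < 1"
    and rad: "\<And>z \<rho>. z \<in> unit_disk \<Longrightarrow> 0 \<le> \<rho> \<Longrightarrow> \<rho> \<le> 1 \<Longrightarrow>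
      cmod (f z - f (of_real \<rho> * z)) \<le> C * (1 - \<rho> * cmod z) powr \<delta>"
    using radial_Hoelder_of_John[OF c l John step] by blast
  show ?thesis
    using Hoelder_of_radial_Hoelder[OF h g f C \<delta> rad] \<delta> by blast
qed

end
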